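(* Let $\mathfrak g$ be a finite-dimensional Lie algebra over a field $K$, let $A$ be an associative unital $K$-algebra containing the universal enveloping algebra $U(\mathfrak g)$ as a subalgebra, and let $X=U(\mathfrak g)\otimes\Lambda(\mathfrak g)$ be the standard free resolution of the trivial left $U(\mathfrak g)$-module $K$. Then the complex $(\mathrm{End}_A(A\otimes_{U(\mathfrak g)}X),\mathbf d)$ is isomorphic to the BRST complex $A^{opp}\otimes C(\mathfrak g+\mathfrak g^* )$ whose differential is the supercommutator by the element $$d=\sum_i e_i\otimes e_i^*+\sum_{i<j}1\otimes[e_i,e_j]\,e_i^*e_j^*\ \in\ A^{opp}\otimes C(\mathfrak g+\mathfrak g^* ),$$ where $(e_i)$ is a linear basis of $\mathfrak g$ and $(e_i^* )$ is the dual basis of $\mathfrak g^*$.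
   Context: The resolution $X=U(\mathfrak g)\otimes\Lambda(\mathfrak g)$ is graded by exterior degree and has differential of degree $-1$ $$d(u\otimes x_1\wedge\dots\wedge x_n)=\sum_{i=1}^n(-1)^{i+1}ux_i\otimes x_1\wedge\dots\wedge\widehat{x_i}\wedge\dots\wedge x_n+\sum_{1\le i<j\le n}(-1)^{i+j}u\otimes[x_i,x_j]\wedge x_1\wedge\dots\wedge\widehat{x_i}\wedge\dots\wedge\widehat{x_j}\wedge\dots\wedge x_n ,$$ where a hat means omission. Thus $A\otimes_{U(\mathfrak g)}X\simeq A\otimes\Lambda(\mathfrak g)$. For a complex $Z=\{Z^p\}$ of left $A$-modules with differential $d:Z^p\to Z^{p-1}$, the graded algebra $\mathrm{End}_A(Z)$ has degree-$n$ component $\prod_p\mathrm{Hom}_A(Z^p,Z^{p-n})$, product given by composition, and differential $\mathbf d f=d\circ f-(-1)^{\deg(f)}f\circ d$ of degree $+1$. $C(\mathfrak g+\mathfrak g^* )$ is the Clifford algebra of $\mathfrak g+\mathfrak g^*$ with the canonical pairing: it is generated by $\mathfrak g$ and $\mathfrak g^*$, elements of $\mathfrak g$ anticommute and square to zero, likewise elements of $\mathfrak g^*$, and $\xi x+x\xi=\xi(x)$ for $x\in\mathfrak g$, $\xi\in\mathfrak g^*$. It acts on $\Lambda(\mathfrak g)$ with $x\in\mathfrak g$ acting by exterior multiplication $x\wedge\cdot$ and $\xi\in\mathfrak g^*$ acting by inner multiplication (contraction); products act as compositions of operators (rightmost factor first). $A^{opp}$ acts on $A$ by right multiplications. The $\mathbb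 Z$-grading on $A^{opp}\otimes C(\mathfrak g+\mathfrak g^* )$ has $A^{opp}$ in degree $0$, $\mathfrak g$ in degree $-1$ and $\mathfrak g^*$ in degree $+1$; modulo 2 it is the usual Clifford $\mathbb Z_2$-grading. The supercommutator by $d$ (an element of degree $1$) is $f\mapsto df-(-1)^{\deg(f)}fd$ for homogeneous $f$. *)

theory Defs
  imports
    Complex_Main
    "HOL-Library.FuncSet"
    "HOL-Library.Poly_Mapping"
    "HOL-Computational_Algebra.Group_Closure"
begin

section \<open>Algebras over a field and Lie algebras\<close>

locale assoc_algebra = vector_space scale
  for scale :: "'k::field \<Rightarrow> 'a::ring_1 \<Rightarrow> 'a" +
  assumes scale_mult_left: "scale c x * y = scale c (x * y)"
    and scale_mult_right: "x * scale c y = scale c (x * y)"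

definition algebra_hom ::
  "('k::field \<Rightarrow> 'a::ring_1 \<Rightarrow> 'a) \<Rightarrow> ('k \<Rightarrow> 'b::ring_1 \<Rightarrow> 'b) \<Rightarrow> ('a \<Rightarrow> 'b) \<Rightarrow> bool" where
  "algebra_hom s1 s2 f \<longleftrightarrow>
     (\<forall>x y. f (x + y) = f x + f y) \<and> (\<forall>x y. f (x * y) = f x * f y) \<and> f 1 = 1 \<and>
     (\<forall>c x. f (s1 c x) = s2 c (f x))"

locale lie_algebra = vector_space scale
  for scale :: "'k::field \<Rightarrow> 'g::ab_group_add \<Rightarrow> 'g" +
  fixes br :: "'g \<Rightarrow> 'g \<Rightarrow> 'g"
  assumes br_add_left: "br (x + y) z = br x z + br y z"
    and br_add_right: "br x (y + z) = br x y + br x z"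
    and br_scale_left: "br (scale c x) y = scale c (br x y)"
    and br_scale_right: "br x (scale c y) = scale c (br x y)"
    and br_self: "br x x = 0"
    and jacobi: "br x (br y z) + br y (br z x) + br z (br x y) = 0"

definition linear_basis ::
  "('k::field \<Rightarrow> 'g::ab_group_add \<Rightarrow> 'g) \<Rightarrow> nat \<Rightarrow> (nat \<Rightarrow> 'g) \<Rightarrow> bool" where
  "linear_basis scale N e \<longleftrightarrow>
     inj_on e {..<N} \<and> \<not> module.dependent scale (e ` {..<N}) \<and>
     module.span scale (e ` {..<N}) = UNIV"

definition dual_basis ::
  "('k::field \<Rightarrow> 'g::ab_group_add \<Rightarrow> 'g) \<Rightarrow> nat \<Rightarrow> (nat \<Rightarrow> 'g) \<Rightarrow> nat \<Rightarrow> 'g \<Rightarrow> 'k" where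
  "dual_basis scale N e i = (\<lambda>v. module.representation scale (e ` {..<N}) v (e i))"

definition dual_space ::
  "('k::field \<Rightarrow> 'g::ab_group_add \<Rightarrow> 'g) \<Rightarrow> ('g \<Rightarrow> 'k) set" where
  "dual_space scale = {\<xi>. Vector_Spaces.linear scale (*) \<xi>}"


section \<open>Algebras given by generators and relations\<close>

text \<open>With words as exponents, the convolution ring of
  \<^theory>\<open>HOL-Library.Poly_Mapping\<close> is the free associative algebra on the letters.\<close>

datatype 'x word = Word (letters: "'x list")

instantiation word :: (type) monoid_add
begin

definition zero_word :: "'x word" where "zero_word = Word []"

definition plus_word :: "'x word \<Rightarrow> 'x word \<Rightarrow> 'x word" where
  "plus_word v w = Word (letters v @ letters w)"

instance
  by standard (simp_all add: zero_word_def plus_word_def)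

end

type_synonym ('x, 'k) free_alg = "'x word \<Rightarrow>\<^sub>0 'k"

definition fgen :: "'x \<Rightarrow> ('x, 'k::field) free_alg" where
  "fgen x = Poly_Mapping.single (Word [x]) 1"

definition fconst :: "'k \<Rightarrow> ('x, 'k::field) free_alg" where
  "fconst c = Poly_Mapping.single 0 c"

definition free_on :: "'x set \<Rightarrow> ('x, 'k::field) free_alg set" where
  "free_on G = {p. \<forall>w\<in>Poly_Mapping.keys p. set (letters w) \<subseteq> G}"

definition free_ideal ::
  "'x set \<Rightarrow> ('x, 'k::field) free_alg set \<Rightarrow> ('x, 'k) free_alg set" where
  "free_ideal G R = group_closure {p * r * q | p r q. p \<in> free_on G \<and> r \<in> R \<and> q \<in> free_on G}"

text \<open>The algebra is the quotient of the free algebra on \<open>G\<close> by the two-sided ideal generated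
  by \<open>R\<close>, with \<open>i x\<close> the class of the generator \<open>x\<close>.  Values of \<open>i\<close> outside \<open>G\<close> are
  irrelevant.\<close>

definition presented_algebra ::
  "('k::field \<Rightarrow> 'b::ring_1 \<Rightarrow> 'b) \<Rightarrow> 'x set \<Rightarrow> ('x, 'k) free_alg set \<Rightarrow> ('x \<Rightarrow> 'b) \<Rightarrow> bool" where
  "presented_algebra scale G R i \<longleftrightarrow>
     assoc_algebra scale \<and>
     (\<exists>F :: ('x, 'k) free_alg \<Rightarrow> 'b.
        additive F \<and> (\<forall>p q. F (p * q) = F p * F q) \<and>
        (\<forall>c. F (fconst c) = scale c 1) \<and> (\<forall>x\<in>G. F (fgen x) = i x) \<and>
        F ` free_on G = UNIV \<and> {p \<in> free_on G. F p = 0} = free_ideal G R)"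

definition linearity_rels ::
  "('k::field \<Rightarrow> 'v::ab_group_add \<Rightarrow> 'v) \<Rightarrow> ('v \<Rightarrow> 'x) \<Rightarrow> ('x, 'k) free_alg set" where
  "linearity_rels scale j =
     {fgen (j (x + y)) - fgen (j x) - fgen (j y) | x y. True} \<union>
     {fgen (j (scale c x)) - fconst c * fgen (j x) | c x. True}"

definition enveloping_algebra ::
  "('k::field \<Rightarrow> 'g::ab_group_add \<Rightarrow> 'g) \<Rightarrow> ('g \<Rightarrow> 'g \<Rightarrow> 'g) \<Rightarrow>
   ('k \<Rightarrow> 'u::ring_1 \<Rightarrow> 'u) \<Rightarrow> ('g \<Rightarrow> 'u) \<Rightarrow> bool" where
  "enveloping_algebra sg br sU iU \<longleftrightarrow>
     presented_algebra sU UNIV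
       (linearity_rels sg id \<union>
        {fgen x * fgen y - fgen y * fgen x - fgen (br x y) | x y. True}) iU"

definition exterior_algebra ::
  "('k::field \<Rightarrow> 'g::ab_group_add \<Rightarrow> 'g) \<Rightarrow> ('k \<Rightarrow> 'l::ring_1 \<Rightarrow> 'l) \<Rightarrow> ('g \<Rightarrow> 'l) \<Rightarrow> bool" where
  "exterior_algebra sg sL iL \<longleftrightarrow>
     presented_algebra sL UNIV (linearity_rels sg id \<union> {fgen x * fgen x | x. True}) iL"

text \<open>In \<open>C(\<gg> + \<gg>\<^sup>*)\<close> the generators are \<open>Inl x\<close> for a vector \<open>x\<close> and \<open>Inr \<xi>\<close> for a linear
  functional \<open>\<xi>\<close>.\<close>

definition clifford_gens ::
  "('k::field \<Rightarrow> 'g::ab_group_add \<Rightarrow> 'g) \<Rightarrow> ('g + ('g \<Rightarrow> 'k)) set" where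
  "clifford_gens sg = range Inl \<union> Inr ` dual_space sg"

definition clifford_rels ::
  "('k::field \<Rightarrow> 'g::ab_group_add \<Rightarrow> 'g) \<Rightarrow> ('g + ('g \<Rightarrow> 'k), 'k) free_alg set" where
  "clifford_rels sg =
     linearity_rels sg Inl \<union>
     {fgen (Inr (\<lambda>v. \<xi> v + \<eta> v)) - fgen (Inr \<xi>) - fgen (Inr \<eta>) | \<xi> \<eta>.
        \<xi> \<in> dual_space sg \<and> \<eta> \<in> dual_space sg} \<union>
     {fgen (Inr (\<lambda>v. c * \<xi> v)) - fconst c * fgen (Inr \<xi>) | c \<xi>. \<xi> \<in> dual_space sg} \<union>
     {fgen (Inl x) * fgen (Inl y) + fgen (Inl y) * fgen (Inl x) | x y. True} \<union>
     {fgen (Inl x) * fgen (Inl x) | x. True} \<union>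
     {fgen (Inr \<xi>) * fgen (Inr \<eta>) + fgen (Inr \<eta>) * fgen (Inr \<xi>) | \<xi> \<eta>.
        \<xi> \<in> dual_space sg \<and> \<eta> \<in> dual_space sg} \<union>
     {fgen (Inr \<xi>) * fgen (Inr \<xi>) | \<xi>. \<xi> \<in> dual_space sg} \<union>
     {fgen (Inr \<xi>) * fgen (Inl x) + fgen (Inl x) * fgen (Inr \<xi>) - fconst (\<xi> x) | \<xi> x.
        \<xi> \<in> dual_space sg}"

definition clifford_algebra ::
  "('k::field \<Rightarrow> 'g::ab_group_add \<Rightarrow> 'g) \<Rightarrow> ('k \<Rightarrow> 'c::ring_1 \<Rightarrow> 'c) \<Rightarrow>
   ('g + ('g \<Rightarrow> 'k) \<Rightarrow> 'c) \<Rightarrow> bool" where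
  "clifford_algebra sg sC iC \<longleftrightarrow>
     presented_algebra sC (clifford_gens sg) (clifford_rels sg) iC"


section \<open>Tensor products\<close>

definition tensor_rels ::
  "('m::ab_group_add \<Rightarrow> 'r \<Rightarrow> 'm) \<Rightarrow> ('r \<Rightarrow> 'n::ab_group_add \<Rightarrow> 'n) \<Rightarrow> ('m \<times> 'n \<Rightarrow>\<^sub>0 int) set" where
  "tensor_rels ra la =
     {frag_of (m + m', n) - frag_of (m, n) - frag_of (m', n) | m m' n. True} \<union>
     {frag_of (m, n + n') - frag_of (m, n) - frag_of (m, n') | m n n'. True} \<union>
     {frag_of (ra m r, n) - frag_of (m, la r n) | m r n. True}"

text \<open>\<open>t m n = m \<otimes> n\<close> exhibits its target as the tensor product of a right module (action \<open>ra\<close>)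
  and a left module (action \<open>la\<close>), that is, as the free abelian group on pairs modulo the usual
  relations.\<close>

definition tensor_product ::
  "('m::ab_group_add \<Rightarrow> 'r \<Rightarrow> 'm) \<Rightarrow> ('r \<Rightarrow> 'n::ab_group_add \<Rightarrow> 'n) \<Rightarrow>
   ('m \<Rightarrow> 'n \<Rightarrow> 't::ab_group_add) \<Rightarrow> bool" where
  "tensor_product ra la t \<longleftrightarrow>
     (\<exists>F :: ('m \<times> 'n \<Rightarrow>\<^sub>0 int) \<Rightarrow> 't.
        additive F \<and> (\<forall>m n. F (frag_of (m, n)) = t m n) \<and> surj F \<and>
        {f. F f = 0} = group_closure (tensor_rels ra la))"

text \<open>The additive map on a tensor product induced by the balanced map \<open>h\<close>.\<close>

definition tensor_lift ::
  "('m \<Rightarrow> 'n \<Rightarrow> 't::ab_group_add) \<Rightarrow> ('m \<Rightarrow> 'n \<Rightarrow> 's::ab_group_add) \<Rightarrow> 't \<Rightarrow> 's" where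
  "tensor_lift t h = (THE H. additive H \<and> (\<forall>m n. H (t m n) = h m n))"

definition left_mult_action ::
  "('a::ring_1 \<Rightarrow> 'n \<Rightarrow> 't::ab_group_add) \<Rightarrow> 'a \<Rightarrow> 't \<Rightarrow> 't" where
  "left_mult_action t a = tensor_lift t (\<lambda>a' n. t (a * a') n)"

definition left_scale ::
  "('k \<Rightarrow> 'a \<Rightarrow> 'a) \<Rightarrow> ('a \<Rightarrow> 'n \<Rightarrow> 't::ab_group_add) \<Rightarrow> 'k \<Rightarrow> 't \<Rightarrow> 't" where
  "left_scale scale t c = tensor_lift t (\<lambda>a n. t (scale c a) n)"

text \<open>\<open>A\<^sup>o\<^sup>p\<^sup>p \<otimes>\<^sub>K C\<close> as an algebra: the first factor multiplies in reverse order, and as it sits in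
  degree 0 no signs occur.\<close>

definition opp_tensor_algebra ::
  "('k::field \<Rightarrow> 'a::ring_1 \<Rightarrow> 'a) \<Rightarrow> ('k \<Rightarrow> 'c::ring_1 \<Rightarrow> 'c) \<Rightarrow> ('a \<Rightarrow> 'c \<Rightarrow> 'b::ring_1) \<Rightarrow> bool" where
  "opp_tensor_algebra sA sC t \<longleftrightarrow>
     tensor_product (\<lambda>a k. sA k a) sC t \<and>
     (\<forall>a a' c c'. t a c * t a' c' = t (a' * a) (c * c')) \<and> t 1 1 = 1"


section \<open>The standard resolution\<close>

definition wedge :: "('g \<Rightarrow> 'l::ring_1) \<Rightarrow> 'g list \<Rightarrow> 'l" where
  "wedge iL xs = prod_list (map iL xs)"

definition exterior_power ::
  "('k::field \<Rightarrow> 'l::ring_1 \<Rightarrow> 'l) \<Rightarrow> ('g \<Rightarrow> 'l) \<Rightarrow> int \<Rightarrow> 'l set" where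
  "exterior_power sL iL p = module.span sL {wedge iL xs | xs. int (length xs) = p}"

text \<open>The differential on \<open>X = U(\<gg>) \<otimes> \<Lambda>(\<gg>)\<close>.  List positions start at 0, so the signs
  \<open>(-1)\<^sup>i\<^sup>+\<^sup>1\<close> and \<open>(-1)\<^sup>i\<^sup>+\<^sup>j\<close> of the usual formula become \<open>(-1)\<^sup>i\<close> and
  \<open>(-1)\<^sup>i\<^sup>+\<^sup>j\<close>; \<open>nths xs (- S)\<close> omits the entries at the positions in \<open>S\<close>.\<close>

definition resolution_diff ::
  "('g \<Rightarrow> 'g \<Rightarrow> 'g) \<Rightarrow> ('g \<Rightarrow> 'u::ring_1) \<Rightarrow> ('g \<Rightarrow> 'l::ring_1) \<Rightarrow>
   ('u \<Rightarrow> 'l \<Rightarrow> 'x::ab_group_add) \<Rightarrow> 'x \<Rightarrow> 'x" where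
  "resolution_diff br iU iL tX =
     (THE D. additive D \<and>
        (\<forall>u xs. D (tX u (wedge iL xs)) =
           (\<Sum>i<length xs. tX ((- 1) ^ i * (u * iU (xs ! i))) (wedge iL (nths xs (- {i})))) +
           (\<Sum>j<length xs. \<Sum>i<j.
              tX ((- 1) ^ (i + j) * u)
                 (iL (br (xs ! i) (xs ! j)) * wedge iL (nths xs (- {i, j}))))))"

definition tensor_component ::
  "('m \<Rightarrow> 'n \<Rightarrow> 't::ab_group_add) \<Rightarrow> (int \<Rightarrow> 'n set) \<Rightarrow> int \<Rightarrow> 't set" where
  "tensor_component t Np p = group_closure {t m n | m n. n \<in> Np p}"


section \<open>Differential graded algebras\<close>

text \<open>Homogeneous components with their operations; multiplication and differential take the
  degrees of their arguments.\<close>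

record ('k, 'v) dga =
  dg_carrier :: "int \<Rightarrow> 'v set"
  dg_zero :: 'v
  dg_add :: "'v \<Rightarrow> 'v \<Rightarrow> 'v"
  dg_scale :: "'k \<Rightarrow> 'v \<Rightarrow> 'v"
  dg_one :: 'v
  dg_mult :: "int \<Rightarrow> int \<Rightarrow> 'v \<Rightarrow> 'v \<Rightarrow> 'v"
  dg_diff :: "int \<Rightarrow> 'v \<Rightarrow> 'v"

definition is_complex :: "('k, 'v) dga \<Rightarrow> bool" where
  "is_complex D \<longleftrightarrow>
     (\<forall>n. \<forall>x\<in>dg_carrier D n.
        dg_diff D n x \<in> dg_carrier D (n + 1) \<and>
        dg_diff D (n + 1) (dg_diff D n x) = dg_zero D)"

definition dga_isomorphism ::
  "('k, 'v) dga \<Rightarrow> ('k, 'w) dga \<Rightarrow> (int \<Rightarrow> 'v \<Rightarrow> 'w) \<Rightarrow> bool" where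
  "dga_isomorphism D E \<phi> \<longleftrightarrow>
     (\<forall>n. bij_betw (\<phi> n) (dg_carrier D n) (dg_carrier E n)) \<and>
     (\<forall>n. \<forall>x\<in>dg_carrier D n. \<forall>y\<in>dg_carrier D n.
        \<phi> n (dg_add D x y) = dg_add E (\<phi> n x) (\<phi> n y)) \<and>
     (\<forall>n c. \<forall>x\<in>dg_carrier D n. \<phi> n (dg_scale D c x) = dg_scale E c (\<phi> n x)) \<and>
     (\<forall>m n. \<forall>x\<in>dg_carrier D m. \<forall>y\<in>dg_carrier D n.
        \<phi> (m + n) (dg_mult D m n x y) = dg_mult E m n (\<phi> m x) (\<phi> n y)) \<and>
     \<phi> 0 (dg_one D) = dg_one E \<and>
     (\<forall>n. \<forall>x\<in>dg_carrier D n. \<phi> (n + 1) (dg_diff D n x) = dg_diff E n (\<phi> n x))"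

definition sgn_pow :: "int \<Rightarrow> 'v::ab_group_add \<Rightarrow> 'v" where
  "sgn_pow n x = (if even n then x else - x)"


section \<open>The endomorphism algebra of a complex\<close>

definition module_homs ::
  "('a \<Rightarrow> 'z::ab_group_add \<Rightarrow> 'z) \<Rightarrow> 'z set \<Rightarrow> 'z set \<Rightarrow> ('z \<Rightarrow> 'z) set" where
  "module_homs act M N =
     {f \<in> M \<rightarrow>\<^sub>E N. (\<forall>x\<in>M. \<forall>y\<in>M. f (x + y) = f x + f y) \<and>
                  (\<forall>a. \<forall>x\<in>M. f (act a x) = act a (f x))}"

text \<open>\<open>act\<close> is the module structure, \<open>sc\<close> the induced \<open>K\<close>-scaling, \<open>Z\<close> the components and
  \<open>d\<close> the differential of the complex.  An element of degree \<open>n\<close> is a family of homomorphisms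
  \<open>f p : Z p \<rightarrow> Z (p - n)\<close>.\<close>

definition End_dga ::
  "('a \<Rightarrow> 'z::ab_group_add \<Rightarrow> 'z) \<Rightarrow> ('k \<Rightarrow> 'z \<Rightarrow> 'z) \<Rightarrow> (int \<Rightarrow> 'z set) \<Rightarrow> ('z \<Rightarrow> 'z) \<Rightarrow>
   ('k, int \<Rightarrow> 'z \<Rightarrow> 'z) dga" where
  "End_dga act sc Z d =
     \<lparr> dg_carrier = (\<lambda>n. {f. \<forall>p. f p \<in> module_homs act (Z p) (Z (p - n))}),
       dg_zero = (\<lambda>p. \<lambda>z\<in>Z p. 0),
       dg_add = (\<lambda>f g p. \<lambda>z\<in>Z p. f p z + g p z),
       dg_scale = (\<lambda>c f p. \<lambda>z\<in>Z p. sc c (f p z)),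
       dg_one = (\<lambda>p. \<lambda>z\<in>Z p. z),
       dg_mult = (\<lambda>m n f g p. compose (Z p) (f (p - n)) (g p)),
       dg_diff = (\<lambda>n f p. \<lambda>z\<in>Z p. d (f p z) - sgn_pow n (f (p - 1) (d z))) \<rparr>"


section \<open>The BRST complex\<close>

fun clifford_deg :: "'g + ('g \<Rightarrow> 'k) \<Rightarrow> int" where
  "clifford_deg (Inl x) = -1"
| "clifford_deg (Inr \<xi>) = 1"

definition clifford_component ::
  "('k::field \<Rightarrow> 'g::ab_group_add \<Rightarrow> 'g) \<Rightarrow> ('k \<Rightarrow> 'c::ring_1 \<Rightarrow> 'c) \<Rightarrow>
   ('g + ('g \<Rightarrow> 'k) \<Rightarrow> 'c) \<Rightarrow> int \<Rightarrow> 'c set" where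
  "clifford_component sg sC iC n =
     module.span sC {prod_list (map iC ws) | ws.
       set ws \<subseteq> clifford_gens sg \<and> sum_list (map clifford_deg ws) = n}"

definition brst_element ::
  "('k::field \<Rightarrow> 'g::ab_group_add \<Rightarrow> 'g) \<Rightarrow> ('g \<Rightarrow> 'g \<Rightarrow> 'g) \<Rightarrow> nat \<Rightarrow> (nat \<Rightarrow> 'g) \<Rightarrow>
   ('g \<Rightarrow> 'a::ring_1) \<Rightarrow> ('g + ('g \<Rightarrow> 'k) \<Rightarrow> 'c::ring_1) \<Rightarrow> ('a \<Rightarrow> 'c \<Rightarrow> 'b::ring_1) \<Rightarrow> 'b" where
  "brst_element sg br N e iA iC tB =
     (\<Sum>i<N. tB (iA (e i)) (iC (Inr (dual_basis sg N e i)))) +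
     (\<Sum>j<N. \<Sum>i<j.
        tB 1 (iC (Inl (br (e i) (e j))) * iC (Inr (dual_basis sg N e i)) *
              iC (Inr (dual_basis sg N e j))))"

definition BRST_dga ::
  "('k \<Rightarrow> 'b::ring_1 \<Rightarrow> 'b) \<Rightarrow> (int \<Rightarrow> 'b set) \<Rightarrow> 'b \<Rightarrow> ('k, 'b) dga" where
  "BRST_dga sc B d =
     \<lparr> dg_carrier = B,
       dg_zero = 0,
       dg_add = (+),
       dg_scale = sc,
       dg_one = 1,
       dg_mult = (\<lambda>m n x y. x * y),
       dg_diff = (\<lambda>n x. d * x - sgn_pow n (x * d)) \<rparr>"

end

theory Submission
  imports Defs "HOL-Library.Product_Plus"
begin

text \<open>
  Write \<open>Z = A \<otimes>\<^sub>U X\<close>.  Associativity of the tensor product turns \<open>Z\<close> into \<open>A \<otimes> \<Lambda>(\<gg>)\<close>, on which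
  \<open>A\<^sup>o\<^sup>p\<^sup>p\<close> acts by right multiplication and the Clifford algebra by exterior multiplication and
  contraction.  Together these give an action \<open>rho\<close> of \<open>A\<^sup>o\<^sup>p\<^sup>p \<otimes> C(\<gg> + \<gg>\<^sup>*)\<close> on \<open>Z\<close> that commutes with
  the left action of \<open>A\<close>, and the isomorphism sends an element to its action on the components
  of \<open>Z\<close>.  Three facts make this work.

  First, \<open>rho\<close> is bijective onto families of \<open>A\<close>-linear maps.  Let \<open>vac\<close> be the product of the
  idempotents \<open>e\<^sub>i\<^sup>* e\<^sub>i\<close> in the Clifford algebra; it acts on \<open>\<Lambda>(\<gg>)\<close> as the projection to degree 0.  For
  ordered monomials \<open>e\<^sub>I\<close>, and \<open>e\<^sub>J\<^sup>*\<close> in the reverse order, the elements \<open>e\<^sub>I vac e\<^sub>J\<^sup>*\<close> are matrix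
  units (\<open>vac_annihil_creat_vac\<close>, \<open>resolution_of_identity\<close>), they span the Clifford algebra
  (\<open>matrix_units_span\<close>), and they act as matrix units on the monomials \<open>e\<^sub>K\<close>
  (\<open>act_unit_monom\<close>), which therefore form a basis of \<open>\<Lambda>(\<gg>)\<close>.  So \<open>Z\<close> is free over \<open>A\<close> on the \<open>e\<^sub>K\<close>,
  an element of the BRST algebra is a matrix over \<open>A\<close>, and \<open>rho\<close> is the usual action of matrices
  (\<open>rho_faithful\<close>, \<open>phi_surj\<close>).  Degrees match because \<open>e\<^sub>I vac e\<^sub>J\<^sup>*\<close> has degree \<open>|J| - |I|\<close>.

  Secondly, the BRST element acts as the differential (\<open>rho_d\<close>): its first sum gives the terms
  with \<open>u x\<^sub>i\<close> and its second sum, which acts on \<open>\<Lambda>(\<gg>)\<close> as \<open>bracket_contr\<close>, those with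
  \<open>[x\<^sub>i, x\<^sub>j]\<close>.  This comparison also proves that the differential of the standard resolution is well
  defined.  Under \<open>rho\<close> the supercommutator with the BRST element becomes the differential of the
  endomorphism algebra.

  Thirdly, the BRST element \<open>d\<close> has square zero.  Put \<open>L\<^sub>y = d y + y d\<close> for exterior multiplication by
  \<open>y\<close>.  Then \<open>L\<^sub>x y - y L\<^sub>x = - [x, y]\<close> and \<open>L\<^sub>x L\<^sub>y - L\<^sub>y L\<^sub>x = - L\<^bsub>[x, y]\<^esub>\<close>, which forces \<open>d\<close> to commute with
  every \<open>L\<^sub>x\<close> and then \<open>d d = 0\<close>, by induction on the number of exterior factors.  All signs are
  handled without dividing by 2, so the characteristic of the field is arbitrary.

  The algebras are given by generators and relations, hence every operator used above is first
  constructed from a universal property (\<open>presented_algebra_action\<close>, \<open>tensor_product_lift_exists\<close>).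
\<close>


section \<open>Subgroups generated by a set and universal properties of tensor products\<close>

lemma group_closure_least:
  assumes "x \<in> group_closure S" and "S \<subseteq> T" and "0 \<in> T"
    and "\<And>a b. a \<in> T \<Longrightarrow> b \<in> T \<Longrightarrow> a - b \<in> T"
  shows "x \<in> T"
  using assms(1) by induction (use assms in auto)

lemma group_closure_base: "s \<in> S \<Longrightarrow> s \<in> group_closure S"
  by (simp add: group_closure.base)

lemma group_closure_sum_mem:
  assumes "\<And>i. i \<in> I \<Longrightarrow> f i \<in> group_closure S"
  shows "sum f I \<in> group_closure S"
  using assms by (induction I rule: infinite_finite_induct) (auto intro: group_closure_add)

text \<open>The equaliser of two additive maps is a subgroup.  All identities between maps out of a
  tensor product are checked on pure tensors by this principle.\<close>

lemma additive_eq_on_group_closure: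
  assumes "additive f" "additive g" "\<And>s. s \<in> S \<Longrightarrow> f s = g s" "x \<in> group_closure S"
  shows "f x = g x"
proof -
  have "x \<in> {x. f x = g x}"
    by (rule group_closure_least[OF assms(4)])
      (auto simp: assms(3) additive.zero[OF assms(1)] additive.zero[OF assms(2)]
          additive.diff[OF assms(1)] additive.diff[OF assms(2)])
  then show ?thesis by simp
qed

lemma additive_image_group_closure:
  assumes "additive f" "\<And>s. s \<in> S \<Longrightarrow> f s \<in> group_closure T" "x \<in> group_closure S"
  shows "f x \<in> group_closure T"
proof -
  have "x \<in> {x. f x \<in> group_closure T}"
    by (rule group_closure_least[OF assms(3)])
      (auto simp: assms(2) additive.zero[OF assms(1)] additive.diff[OF assms(1)]
        intro: group_closure.diff)
  then show ?thesis by simp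
qed

lemma additive_compose: "additive f \<Longrightarrow> additive g \<Longrightarrow> additive (\<lambda>x. f (g x))"
  by (simp add: additive_def)

lemma additive_add: "additive f \<Longrightarrow> additive g \<Longrightarrow> additive (\<lambda>x. f x + g x :: 'b::ab_group_add)"
  by (simp add: additive_def algebra_simps)

lemma additive_diff: "additive f \<Longrightarrow> additive g \<Longrightarrow> additive (\<lambda>x. f x - g x :: 'b::ab_group_add)"
  by (simp add: additive_def algebra_simps)

lemma additive_sum:
  "(\<And>i. i \<in> I \<Longrightarrow> additive (f i)) \<Longrightarrow> additive (\<lambda>x. \<Sum>i\<in>I. f i x :: 'b::ab_group_add)"
  by (simp add: additive_def sum.distrib)

text \<open>Integer multiples in an abelian group, needed to extend a map from pairs to the free
  abelian group on pairs.\<close>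

definition int_mult :: "int \<Rightarrow> 'h::ab_group_add \<Rightarrow> 'h" where
  "int_mult n x = (\<Sum>i\<in>{0..<n}. x) - (\<Sum>i\<in>{n..<0}. x)"

lemma int_mult_add_one: "int_mult (n + 1) x = int_mult n x + x"
proof (cases "n \<ge> 0")
  case True
  then have "{0..<n + 1} = insert n {0..<n}" by auto
  with True show ?thesis by (simp add: int_mult_def)
next
  case False
  then have "{n..<0} = insert n {n + 1..<0}" by auto
  with False show ?thesis by (simp add: int_mult_def)
qed

lemma int_mult_add: "int_mult (m + n) x = int_mult m x + int_mult n x"
proof (induction n rule: int_induct[where k = 0])
  case base
  show ?case by (simp add: int_mult_def)
next
  case (step1 i)
  have "int_mult (m + (i + 1)) x = int_mult (m + i) x + x"
    by (subst add.assoc[symmetric]) (rule int_mult_add_one)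
  then show ?case by (simp only: step1 int_mult_add_one add.assoc)
next
  case (step2 i)
  have "int_mult (m + i) x = int_mult (m + (i - 1)) x + x"
    by (subst int_mult_add_one[symmetric]) (simp add: algebra_simps)
  moreover have "int_mult i x = int_mult (i - 1) x + x"
    by (subst int_mult_add_one[symmetric]) simp
  ultimately have "int_mult (m + (i - 1)) x + x = int_mult m x + int_mult (i - 1) x + x"
    by (simp only: step2 add.assoc)
  then show ?case by (simp only: add_right_cancel)
qed

lemma int_mult_0 [simp]: "int_mult 0 x = 0"
  by (simp add: int_mult_def)

lemma int_mult_1 [simp]: "int_mult 1 x = x"
  using int_mult_add_one[of 0 x] by simp

lemma free_abelian_group_lift:
  fixes h :: "'p \<Rightarrow> 'h::ab_group_add"
  obtains H :: "('p \<Rightarrow>\<^sub>0 int) \<Rightarrow> 'h" where "additive H" "\<And>p. H (frag_of p) = h p"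
proof
  let ?H = "\<lambda>f. \<Sum>p\<in>Poly_Mapping.keys f. int_mult (Poly_Mapping.lookup f p) (h p)"
  show "additive ?H"
    by (rule additive.intro, rule setsum_keys_plus_distrib) (simp_all add: int_mult_add)
  show "?H (frag_of p) = h p" for p
    by simp
qed

definition balanced_map ::
  "('m::ab_group_add \<Rightarrow> 'r \<Rightarrow> 'm) \<Rightarrow> ('r \<Rightarrow> 'n::ab_group_add \<Rightarrow> 'n) \<Rightarrow>
   ('m \<Rightarrow> 'n \<Rightarrow> 'h::ab_group_add) \<Rightarrow> bool" where
  "balanced_map ra la h \<longleftrightarrow>
     (\<forall>m m' n. h (m + m') n = h m n + h m' n) \<and> (\<forall>m n n'. h m (n + n') = h m n + h m n') \<and>
     (\<forall>m r n. h (ra m r) n = h m (la r n))"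

lemma balanced_mapI:
  assumes "\<And>m m' n. h (m + m') n = h m n + h m' n" "\<And>m n n'. h m (n + n') = h m n + h m n'"
    "\<And>m r n. h (ra m r) n = h m (la r n)"
  shows "balanced_map ra la h"
  using assms by (simp add: balanced_map_def)

lemma tensor_product_balanced:
  assumes "tensor_product ra la t"
  shows "balanced_map ra la t"
proof -
  obtain F where F: "additive F" "\<And>m n. F (frag_of (m, n)) = t m n"
    "{f. F f = 0} = group_closure (tensor_rels ra la)"
    using assms unfolding tensor_product_def by blast
  have 0: "F f = 0" if "f \<in> tensor_rels ra la" for f
    using F(3) group_closure_base[OF that] by auto
  note F_simps = F(2) additive.diff[OF F(1)] additive.add[OF F(1)]
  show ?thesis
  proof (rule balanced_mapI)
    show "t (m + m') n = t m n + t m' n" for m m' n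
    proof -
      have "F (frag_of (m + m', n) - frag_of (m, n) - frag_of (m', n)) = 0"
        by (rule 0) (unfold tensor_rels_def, blast)
      then show ?thesis by (simp add: F_simps diff_diff_eq)
    qed
    show "t m (n + n') = t m n + t m n'" for m n n'
    proof -
      have "F (frag_of (m, n + n') - frag_of (m, n) - frag_of (m, n')) = 0"
        by (rule 0) (unfold tensor_rels_def, blast)
      then show ?thesis by (simp add: F_simps diff_diff_eq)
    qed
    show "t (ra m r) n = t m (la r n)" for m r n
    proof -
      have "F (frag_of (ra m r, n) - frag_of (m, la r n)) = 0"
        by (rule 0) (unfold tensor_rels_def, blast)
      then show ?thesis by (simp add: F_simps)
    qed
  qed
qed

lemma tensor_product_generated:
  assumes "tensor_product ra la t"
  shows "z \<in> group_closure {t m n | m n. True}"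
proof -
  obtain F where F: "additive F" "\<And>m n. F (frag_of (m, n)) = t m n" "surj F"
    using assms unfolding tensor_product_def by blast
  obtain f where f: "z = F f" using F(3) by blast
  have "F f \<in> group_closure {t m n | m n. True}"
  proof (rule frag_induction[of f UNIV])
    show "F (frag_of x) \<in> group_closure {t m n | m n. True}" for x
      by (cases x) (auto simp: F intro!: group_closure_base)
  qed (auto simp: additive.zero[OF F(1)] additive.diff[OF F(1)] intro: group_closure.diff)
  then show ?thesis using f by simp
qed

lemma tensor_product_ext:
  assumes "tensor_product ra la t" "additive f" "additive g" "\<And>m n. f (t m n) = g (t m n)"
  shows "f z = g z"
  by (rule additive_eq_on_group_closure[OF assms(2,3) _ tensor_product_generated[OF assms(1)]])
    (use assms(4) in auto)

text \<open>The extension of \<open>h\<close> to the free abelian group on pairs vanishes on the defining relations,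
  hence factors through any presentation \<open>F\<close> of the tensor product.\<close>

lemma tensor_product_lift_exists:
  fixes h :: "'m::ab_group_add \<Rightarrow> 'n::ab_group_add \<Rightarrow> 'h::ab_group_add"
  assumes t: "tensor_product ra la t" and h: "balanced_map ra la h"
  shows "\<exists>H. additive H \<and> (\<forall>m n. H (t m n) = h m n)"
proof -
  obtain F where F: "additive F" "\<And>m n. F (frag_of (m, n)) = t m n" "surj F"
    "{f. F f = 0} = group_closure (tensor_rels ra la)"
    using t unfolding tensor_product_def by blast
  obtain G where G: "additive G" "\<And>p. G (frag_of p) = (\<lambda>(m, n). h m n) p"
    using free_abelian_group_lift[of "\<lambda>(m, n). h m n"] by blast
  have h1: "h (m + m') n = h m n + h m' n" and h2: "h m (n + n') = h m n + h m n'"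
    and h3: "h (ra m r) n = h m (la r n)" for m m' n n' r
    using h unfolding balanced_map_def by blast+
  have G0: "G f = 0" if "F f = 0" for f
  proof -
    have "f \<in> group_closure (tensor_rels ra la)" using that F(4) by auto
    then have "f \<in> {f. G f = 0}"
      by (rule group_closure_least)
        (unfold tensor_rels_def,
        auto simp: h1 h2 h3 G(2) additive.diff[OF G(1)] additive.zero[OF G(1)])
    then show ?thesis by simp
  qed
  have Geq: "G f = G f'" if "F f = F f'" for f f'
    using G0[of "f - f'"] that by (simp add: additive.diff[OF F(1)] additive.diff[OF G(1)])
  let ?H = "\<lambda>z. G (inv F z)"
  have H: "?H (F f) = G f" for f
    by (rule Geq) (simp add: F(3) surj_f_inv_f)
  have "?H (x + y) = ?H x + ?H y" for x y
    using H[of "inv F x + inv F y"]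
    by (simp add: additive.add[OF F(1)] additive.add[OF G(1)] surj_f_inv_f[OF F(3)])
  moreover have "?H (t m n) = h m n" for m n
    using H[of "frag_of (m, n)"] F(2) G(2) by simp
  ultimately show ?thesis
    by (intro exI[of _ ?H] conjI allI additive.intro)
qed

lemma
  assumes t: "tensor_product ra la t" and h: "balanced_map ra la h"
  shows additive_tensor_lift: "additive (tensor_lift t h)"
    and tensor_lift_apply: "tensor_lift t h (t m n) = h m n"
proof -
  have "\<exists>!H. additive H \<and> (\<forall>m n. H (t m n) = h m n)"
  proof (rule ex_ex1I)
    show "\<exists>H. additive H \<and> (\<forall>m n. H (t m n) = h m n)"
      by (rule tensor_product_lift_exists[OF t h])
    show "H = H'"
      if "additive H \<and> (\<forall>m n. H (t m n) = h m n)" "additive H' \<and> (\<forall>m n. H' (t m n) = h m n)"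
      for H H'
    proof
      show "H z = H' z" for z
        by (rule tensor_product_ext[OF t]) (simp_all add: that)
    qed
  qed
  from theI'[OF this]
  have "additive (tensor_lift t h) \<and> (\<forall>m n. tensor_lift t h (t m n) = h m n)"
    unfolding tensor_lift_def .
  then show "additive (tensor_lift t h)" "tensor_lift t h (t m n) = h m n"
    by blast+
qed


section \<open>Modules over algebras given by generators and relations\<close>

lemma poly_mapping_additive_ext:
  assumes "additive f" "additive g"
    "\<And>k c. f (Poly_Mapping.single k c) = g (Poly_Mapping.single k c)"
  shows "f p = g p"
proof -
  have expand: "p = (\<Sum>k\<in>Poly_Mapping.keys p. Poly_Mapping.single k (Poly_Mapping.lookup p k))"
  proof (rule poly_mapping_eqI)
    fix k
    have "Poly_Mapping.lookup (\<Sum>k\<in>Poly_Mapping.keys p.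
        Poly_Mapping.single k (Poly_Mapping.lookup p k)) k =
      (\<Sum>j\<in>Poly_Mapping.keys p. if j = k then Poly_Mapping.lookup p j else 0)"
      by (simp add: lookup_sum lookup_single when_def)
    then show "Poly_Mapping.lookup p k = Poly_Mapping.lookup (\<Sum>k\<in>Poly_Mapping.keys p.
        Poly_Mapping.single k (Poly_Mapping.lookup p k)) k"
      by (simp add: in_keys_iff)
  qed
  show ?thesis
    by (subst (1 2) expand) (simp add: additive.sum[OF assms(1)] additive.sum[OF assms(2)] assms(3))
qed

text \<open>A family of operators \<open>T\<close> indexed by the letters makes any vector space a module over
  the free algebra.\<close>

definition word_action ::
  "('k::field \<Rightarrow> 'm::ab_group_add \<Rightarrow> 'm) \<Rightarrow> ('x \<Rightarrow> 'm \<Rightarrow> 'm) \<Rightarrow> ('x, 'k) free_alg \<Rightarrow> 'm \<Rightarrow> 'm" where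
  "word_action sM T p m =
     (\<Sum>w\<in>Poly_Mapping.keys p. sM (Poly_Mapping.lookup p w) (foldr T (letters w) m))"

locale operator_family = vector_space sM
  for sM :: "'k::field \<Rightarrow> 'm::ab_group_add \<Rightarrow> 'm" +
  fixes T :: "'x \<Rightarrow> 'm \<Rightarrow> 'm"
  assumes T_add: "T x (m + m') = T x m + T x m'" and T_scale: "T x (sM c m) = sM c (T x m)"
begin

lemma foldr_add: "foldr T w (m + m') = foldr T w m + foldr T w m'"
  by (induction w) (simp_all add: T_add)

lemma foldr_scale: "foldr T w (sM c m) = sM c (foldr T w m)"
  by (induction w) (simp_all add: T_scale)

lemma word_action_single:
  "word_action sM T (Poly_Mapping.single w c) m = sM c (foldr T (letters w) m)"
  by (cases "c = 0") (simp_all add: word_action_def)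

lemma additive_word_action: "additive (\<lambda>p. word_action sM T p m)"
  unfolding word_action_def
  by (rule additive.intro, rule setsum_keys_plus_distrib) (simp_all add: scale_left_distrib)

lemma word_action_add_right:
  "word_action sM T p (m + m') = word_action sM T p m + word_action sM T p m'"
  by (simp add: word_action_def foldr_add scale_right_distrib sum.distrib)

lemma word_action_scale_right: "word_action sM T p (sM c m) = sM c (word_action sM T p m)"
  by (simp add: word_action_def foldr_scale scale_sum_right mult.commute)

lemma word_action_mult: "word_action sM T (p * q) m = word_action sM T p (word_action sM T q m)"
proof (rule poly_mapping_additive_ext[of "\<lambda>p :: ('x, 'k) free_alg. word_action sM T (p * q) m"
      "\<lambda>p. word_action sM T p (word_action sM T q m)"])
  show "additive (\<lambda>p. word_action sM T (p * q) m)"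
    using additive_word_action[of m] by (simp add: additive_def distrib_right)
  show "additive (\<lambda>p. word_action sM T p (word_action sM T q m))"
    by (rule additive_word_action)
  fix w :: "'x word" and c :: 'k
  let ?p = "Poly_Mapping.single w c"
  show "word_action sM T (?p * q) m = word_action sM T ?p (word_action sM T q m)"
  proof (rule poly_mapping_additive_ext[of "\<lambda>q. word_action sM T (?p * q) m"
        "\<lambda>q. word_action sM T ?p (word_action sM T q m)"])
    show "additive (\<lambda>q. word_action sM T (?p * q) m)"
      using additive_word_action[of m] by (simp add: additive_def distrib_left)
    show "additive (\<lambda>q. word_action sM T ?p (word_action sM T q m))"
      using additive_word_action[of m] by (simp add: additive_def word_action_add_right)
  qed (simp add: mult_single word_action_single plus_word_def foldr_scale)
qed

lemma word_action_fgen: "word_action sM T (fgen x) m = T x m"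
  by (simp add: fgen_def word_action_single)

lemma word_action_fconst: "word_action sM T (fconst c) m = sM c m"
  by (simp add: fconst_def word_action_single zero_word_def)

lemma word_action_zero: "word_action sM T 0 m = 0"
  by (rule additive.zero[OF additive_word_action])

lemmas word_action_simps =
  additive.add[OF additive_word_action] additive.diff[OF additive_word_action]
  word_action_mult word_action_fgen word_action_fconst word_action_zero

lemma word_action_zero_right: "word_action sM T p 0 = 0"
  using word_action_add_right[of p 0 0] by simp

text \<open>A relator acts as \<open>0\<close> on every vector, so it still does between arbitrary factors.\<close>

lemma word_action_free_ideal:
  assumes "\<And>r m. r \<in> R \<Longrightarrow> word_action sM T r m = 0" and "p \<in> free_ideal G R"
  shows "word_action sM T p m = 0"
proof -
  have "p \<in> {p. \<forall>m. word_action sM T p m = 0}"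
    using assms(2) unfolding free_ideal_def
    by (rule group_closure_least)
      (auto simp: word_action_simps assms(1) word_action_zero_right)
  then show ?thesis by simp
qed

end

definition algebra_action ::
  "('k::field \<Rightarrow> 'b::ring_1 \<Rightarrow> 'b) \<Rightarrow> ('k \<Rightarrow> 'm::ab_group_add \<Rightarrow> 'm) \<Rightarrow> ('b \<Rightarrow> 'm \<Rightarrow> 'm) \<Rightarrow> bool" where
  "algebra_action sB sM \<rho> \<longleftrightarrow>
     (\<forall>b c m. \<rho> (b + c) m = \<rho> b m + \<rho> c m) \<and> (\<forall>b m m'. \<rho> b (m + m') = \<rho> b m + \<rho> b m') \<and>
     (\<forall>b c m. \<rho> (b * c) m = \<rho> b (\<rho> c m)) \<and> (\<forall>m. \<rho> 1 m = m) \<and>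
     (\<forall>k b m. \<rho> (sB k b) m = sM k (\<rho> b m)) \<and> (\<forall>k b m. \<rho> b (sM k m) = sM k (\<rho> b m))"

lemma
  assumes "algebra_action sB sM \<rho>"
  shows algebra_action_add_left: "\<rho> (b + c) m = \<rho> b m + \<rho> c m"
    and algebra_action_add_right: "\<rho> b (m + m') = \<rho> b m + \<rho> b m'"
    and algebra_action_mult: "\<rho> (b * c) m = \<rho> b (\<rho> c m)"
    and algebra_action_one: "\<rho> 1 m = m"
    and algebra_action_scale_left: "\<rho> (sB k b) m = sM k (\<rho> b m)"
    and algebra_action_scale_right: "\<rho> b (sM k m) = sM k (\<rho> b m)"
  using assms by (simp_all add: algebra_action_def)

lemmas algebra_action_simps = algebra_action_add_left algebra_action_add_right
  algebra_action_mult algebra_action_one algebra_action_scale_left algebra_action_scale_right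

text \<open>The universal property in the form used throughout: operators that satisfy the defining
  relations extend to an action of the presented algebra.\<close>

lemma presented_algebra_action:
  fixes sB :: "'k::field \<Rightarrow> 'b::ring_1 \<Rightarrow> 'b" and i :: "'x \<Rightarrow> 'b"
  assumes B: "presented_algebra sB G R i" and T: "operator_family sM T"
    and rels: "\<And>r m. r \<in> R \<Longrightarrow> word_action sM T r m = 0"
  shows "\<exists>\<rho>. algebra_action sB sM \<rho> \<and> (\<forall>x\<in>G. \<forall>m. \<rho> (i x) m = T x m)"
proof -
  interpret T: operator_family sM T by fact
  interpret B: assoc_algebra sB using B by (simp add: presented_algebra_def)
  obtain F :: "('x, 'k) free_alg \<Rightarrow> 'b" where F: "additive F" "\<And>p q. F (p * q) = F p * F q"
    "\<And>c. F (fconst c) = sB c 1" "\<And>x. x \<in> G \<Longrightarrow> F (fgen x) = i x" "F ` free_on G = UNIV"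
    "{p \<in> free_on G. F p = 0} = free_ideal G R"
    using B unfolding presented_algebra_def by blast
  let ?w = "word_action sM T"
  have diff: "p - q \<in> free_on G" if "p \<in> free_on G" "q \<in> free_on G" for p q :: "('x, 'k) free_alg"
    using that keys_diff[of p q] by (auto simp: free_on_def in_keys_iff lookup_minus)
  have add: "p + q \<in> free_on G" if "p \<in> free_on G" "q \<in> free_on G" for p q :: "('x, 'k) free_alg"
    using that Poly_Mapping.keys_add[of p q] by (auto simp: free_on_def)
  have mult: "p * q \<in> free_on G" if "p \<in> free_on G" "q \<in> free_on G" for p q :: "('x, 'k) free_alg"
    using that keys_mult[of p q] by (fastforce simp: free_on_def plus_word_def)
  have const: "fconst c \<in> free_on G" for c :: 'k
    by (auto simp: free_on_def fconst_def zero_word_def split: if_splits)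
  have gen: "fgen x \<in> free_on G" if "x \<in> G" for x
    using that by (auto simp: free_on_def fgen_def)
  define pre where "pre b = (SOME p. p \<in> free_on G \<and> F p = b)" for b
  have pre: "pre b \<in> free_on G \<and> F (pre b) = b" for b
    unfolding pre_def by (rule someI_ex) (metis F(5) UNIV_I imageE)
  have eq: "?w p m = ?w (pre (F p)) m" if "p \<in> free_on G" for p m
  proof -
    have "p - pre (F p) \<in> free_ideal G R"
      using F(6) diff[OF that] pre[of "F p"] by (auto simp: additive.diff[OF F(1)])
    from T.word_action_free_ideal[OF rels this, of m] show ?thesis
      by (simp add: T.word_action_simps)
  qed
  let ?r = "\<lambda>b. ?w (pre b)"
  show ?thesis
    unfolding algebra_action_def
  proof (intro exI[of _ ?r] conjI allI ballI)
    show "?r (b + c) m = ?r b m + ?r c m" for b c m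
      using eq[of "pre b + pre c" m] pre add
      by (simp add: additive.add[OF F(1)] T.word_action_simps)
    show "?r b (m + m') = ?r b m + ?r b m'" for b m m'
      by (rule T.word_action_add_right)
    show "?r (b * c) m = ?r b (?r c m)" for b c m
      using eq[of "pre b * pre c" m] pre mult by (simp add: F(2) T.word_action_simps)
    show "?r 1 m = m" for m
      using eq[OF const, of 1 m] by (simp add: F(3) T.word_action_simps)
    show "?r (sB k b) m = sM k (?r b m)" for k b m
      using eq[of "fconst k * pre b" m] pre const mult
      by (simp add: F(2,3) T.word_action_simps B.scale_mult_left)
    show "?r b (sM k m) = sM k (?r b m)" for k b m
      by (rule T.word_action_scale_right)
    show "?r (i x) m = T x m" if "x \<in> G" for x m
      using eq[OF gen[OF that], of m] by (simp add: F(4)[OF that] T.word_action_simps)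
  qed
qed

text \<open>Since the presentation is surjective, the algebra is spanned by words in the generators, and
  a word is built by multiplying from the left.\<close>

lemma presented_algebra_induct [consumes 1, case_names one gen add scale]:
  fixes sB :: "'k::field \<Rightarrow> 'b::ring_1 \<Rightarrow> 'b" and i :: "'x \<Rightarrow> 'b"
  assumes B: "presented_algebra sB G R i"
    and one: "P 1" and gen: "\<And>x b. x \<in> G \<Longrightarrow> P b \<Longrightarrow> P (i x * b)"
    and add: "\<And>b c. P b \<Longrightarrow> P c \<Longrightarrow> P (b + c)" and scale: "\<And>k b. P b \<Longrightarrow> P (sB k b)"
  shows "P b"
proof -
  interpret B: assoc_algebra sB using B by (simp add: presented_algebra_def)
  obtain F :: "('x, 'k) free_alg \<Rightarrow> 'b" where F: "additive F" "\<And>p q. F (p * q) = F p * F q"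
    "\<And>c. F (fconst c) = sB c 1" "\<And>x. x \<in> G \<Longrightarrow> F (fgen x) = i x" "F ` free_on G = UNIV"
    using B unfolding presented_algebra_def by blast
  have zero: "P 0" using scale[OF one, of 0] by simp
  have word: "P (F (Poly_Mapping.single (Word w) 1))" if "set w \<subseteq> G" for w
    using that
  proof (induction w)
    case Nil
    have "Poly_Mapping.single (Word []) 1 = (fconst 1 :: ('x, 'k) free_alg)"
      by (simp add: fconst_def zero_word_def)
    then show ?case using one by (simp add: F(3))
  next
    case (Cons x w)
    have "Poly_Mapping.single (Word (x # w)) 1 =
        fgen x * (Poly_Mapping.single (Word w) 1 :: ('x, 'k) free_alg)"
      by (simp add: fgen_def mult_single plus_word_def)
    with Cons show ?case by (simp add: F(2,4) gen)
  qed
  have monom: "P (F (Poly_Mapping.single w c))" if "set (letters w) \<subseteq> G" for w c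
  proof -
    have "Poly_Mapping.single w c = fconst c * Poly_Mapping.single (Word (letters w)) 1"
      by (simp add: fconst_def mult_single)
    then show ?thesis using scale[OF word[OF that], of c] by (simp add: F B.scale_mult_left)
  qed
  obtain p where p: "p \<in> free_on G" "b = F p" using F(5) by (metis UNIV_I imageE)
  have expand: "p = (\<Sum>w\<in>Poly_Mapping.keys p. Poly_Mapping.single w (Poly_Mapping.lookup p w))"
    by (rule poly_mapping_eqI)
      (simp add: lookup_sum lookup_single when_def in_keys_iff)
  have "P (F (\<Sum>w\<in>W. Poly_Mapping.single w (Poly_Mapping.lookup p w)))"
    if "finite W" "W \<subseteq> Poly_Mapping.keys p" for W
    using that
  proof (induction W rule: finite_induct)
    case empty
    show ?case using zero by (simp add: additive.zero[OF F(1)])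
  next
    case (insert w W)
    then show ?case using p(1)
      by (auto simp: additive.add[OF F(1)] free_on_def intro!: add monom)
  qed
  from this[of "Poly_Mapping.keys p"] show ?thesis
    using p(2) expand by simp
qed

definition free_algebra_map ::
  "('k::field \<Rightarrow> 'b::ring_1 \<Rightarrow> 'b) \<Rightarrow> 'x set \<Rightarrow> ('x \<Rightarrow> 'b) \<Rightarrow> (('x, 'k) free_alg \<Rightarrow> 'b) \<Rightarrow> bool" where
  "free_algebra_map sB G i F \<longleftrightarrow>
     additive F \<and> (\<forall>p q. F (p * q) = F p * F q) \<and> (\<forall>c. F (fconst c) = sB c 1) \<and>
     (\<forall>x\<in>G. F (fgen x) = i x)"

lemma
  assumes "free_algebra_map sB G i F"
  shows free_algebra_map_add: "F (p + q) = F p + F q"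
    and free_algebra_map_diff: "F (p - q) = F p - F q"
    and free_algebra_map_mult: "F (p * q) = F p * F q"
    and free_algebra_map_const: "F (fconst c) = sB c 1"
    and free_algebra_map_gen: "x \<in> G \<Longrightarrow> F (fgen x) = i x"
  using assms additive.add[of F p q] additive.diff[of F p q] by (simp_all add: free_algebra_map_def)

lemmas free_algebra_map_simps = free_algebra_map_add free_algebra_map_diff free_algebra_map_mult
  free_algebra_map_const free_algebra_map_gen

lemma presented_algebra_relations:
  assumes B: "presented_algebra sB G R i"
  shows "\<exists>F. free_algebra_map sB G i F \<and> (\<forall>r\<in>R. F r = 0)"
proof -
  obtain F where F: "free_algebra_map sB G i F" "{p \<in> free_on G. F p = 0} = free_ideal G R"
    using B unfolding presented_algebra_def free_algebra_map_def by blast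
  have "r \<in> free_ideal G R" if "r \<in> R" for r
    unfolding free_ideal_def using that
    by (intro group_closure_base CollectI exI[of _ 1] exI[of _ r])
      (auto simp: free_on_def zero_word_def)
  then have "F r = 0" if "r \<in> R" for r
    using that F(2) by blast
  with F(1) show ?thesis by blast
qed


section \<open>Matrix units from creation and annihilation elements\<close>

text \<open>In a ring with \<open>N\<close> pairs of creation elements \<open>a\<^sub>i\<close> and annihilation elements \<open>b\<^sub>i\<close> the
  product \<open>vac\<close> of the commuting idempotents \<open>b\<^sub>i a\<^sub>i\<close> is killed by every \<open>b\<^sub>i\<close> on the left and by
  every \<open>a\<^sub>i\<close> on the right.  Hence the elements \<open>a\<^sub>I vac b\<^sub>J\<close> multiply like matrix units.\<close>

locale fermions =
  fixes N :: nat and a b :: "nat \<Rightarrow> 'c::ring_1"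
  assumes aa: "i < N \<Longrightarrow> j < N \<Longrightarrow> a i * a j = - (a j * a i)"
    and bb: "i < N \<Longrightarrow> j < N \<Longrightarrow> b i * b j = - (b j * b i)"
    and a_sq: "i < N \<Longrightarrow> a i * a i = 0" and b_sq: "i < N \<Longrightarrow> b i * b i = 0"
    and ba: "i < N \<Longrightarrow> j < N \<Longrightarrow> b i * a j = (if i = j then 1 else 0) - a j * b i"
begin

primrec vac_below :: "nat \<Rightarrow> 'c" where
  "vac_below 0 = 1"
| "vac_below (Suc m) = vac_below m * (b m * a m)"

definition vac :: 'c where "vac = vac_below N"

lemma a_commute_ba:
  assumes "i < N" "j < N" "i \<noteq> j"
  shows "a j * (b i * a i) = b i * a i * a j"
proof -
  have "a j * (b i * a i) = (a j * b i) * a i" by (simp add: mult.assoc)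
  also have "a j * b i = - (b i * a j)" using ba[of i j] assms by simp
  also have "- (b i * a j) * a i = - (b i * (a j * a i))" by (simp add: mult.assoc)
  also have "\<dots> = b i * a i * a j" using aa[of j i] assms by (simp add: mult.assoc)
  finally show ?thesis .
qed

lemma b_commute_ba:
  assumes "i < N" "j < N" "i \<noteq> j"
  shows "b j * (b i * a i) = b i * a i * b j"
proof -
  have "b j * (b i * a i) = - (b i * (b j * a i))"
    using bb[of j i] assms by (simp flip: mult.assoc)
  also have "\<dots> = b i * a i * b j" using ba[of j i] assms by (simp add: mult.assoc)
  finally show ?thesis .
qed

lemma a_commute_vac_below: "m \<le> j \<Longrightarrow> j < N \<Longrightarrow> a j * vac_below m = vac_below m * a j"
proof (induction m)
  case (Suc m)
  have "a j * vac_below (Suc m) = vac_below m * (a j * (b m * a m))"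
    using Suc by (simp flip: mult.assoc)
  also have "\<dots> = vac_below (Suc m) * a j"
    using a_commute_ba[of m j] Suc.prems by (simp add: mult.assoc)
  finally show ?case .
qed simp

lemma b_commute_vac_below: "m \<le> j \<Longrightarrow> j < N \<Longrightarrow> b j * vac_below m = vac_below m * b j"
proof (induction m)
  case (Suc m)
  have "b j * vac_below (Suc m) = vac_below m * (b j * (b m * a m))"
    using Suc by (simp flip: mult.assoc)
  also have "\<dots> = vac_below (Suc m) * b j"
    using b_commute_ba[of m j] Suc.prems by (simp add: mult.assoc)
  finally show ?case .
qed simp

lemma aba: "i < N \<Longrightarrow> a i * b i * a i = a i"
  using ba[of i i] a_sq[of i] by (simp add: right_diff_distrib mult.assoc flip: mult.assoc[of "a i" "a i"])

lemma b_vac_below: "j < m \<Longrightarrow> m \<le> N \<Longrightarrow> b j * vac_below m = 0"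
proof (induction m)
  case (Suc m)
  show ?case
  proof (cases "j = m")
    case True
    then have "b j * vac_below (Suc m) = vac_below m * (b m * b m) * a m"
      using b_commute_vac_below[of m j] Suc.prems by (simp flip: mult.assoc)
    then show ?thesis using b_sq[of m] Suc.prems by simp
  next
    case False
    with Suc show ?thesis by (simp flip: mult.assoc)
  qed
qed simp

lemma vac_below_a: "j < m \<Longrightarrow> m \<le> N \<Longrightarrow> vac_below m * a j = 0"
proof (induction m)
  case (Suc m)
  show ?case
  proof (cases "j = m")
    case True
    then show ?thesis using a_sq[of m] Suc.prems by (simp add: mult.assoc)
  next
    case False
    then have "vac_below (Suc m) * a j = vac_below m * a j * (b m * a m)"
      using a_commute_ba[of m j] Suc.prems by (simp add: mult.assoc)
    with False Suc show ?thesis by simp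
  qed
qed simp

lemma b_vac: "j < N \<Longrightarrow> b j * vac = 0" and vac_a: "j < N \<Longrightarrow> vac * a j = 0"
  by (simp_all add: vac_def b_vac_below vac_below_a)

lemma ba_vac: "j < N \<Longrightarrow> b j * a j * vac = vac"
  using ba[of j j] b_vac[of j] by (simp add: left_diff_distrib mult.assoc)

lemma vac_idem: "vac * vac = vac"
proof -
  have "m \<le> N \<Longrightarrow> vac_below m * vac = vac" for m
    by (induction m) (simp_all add: ba_vac mult.assoc[of "vac_below _"])
  from this[of N] show ?thesis by (simp add: vac_def)
qed

text \<open>Subsets of \<open>{..<N}\<close> index monomials; the entries are listed in increasing order, and the
  annihilators are taken in the opposite order so that \<open>annihil I * creat I\<close> has vacuum
  component \<open>1\<close> without a sign.\<close>

definition entries :: "nat \<Rightarrow> nat set \<Rightarrow> nat list" where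
  "entries m I = filter (\<lambda>i. i \<in> I) [0..<m]"

definition creat :: "nat list \<Rightarrow> 'c" where "creat w = prod_list (map a w)"
definition annihil :: "nat list \<Rightarrow> 'c" where "annihil w = prod_list (map b (rev w))"

lemma creat_simps [simp]: "creat [] = 1" "creat (i # w) = a i * creat w"
  "creat (v @ w) = creat v * creat w"
  by (simp_all add: creat_def)

lemma annihil_simps [simp]: "annihil [] = 1" "annihil (i # w) = annihil w * b i"
  "annihil (v @ w) = annihil w * annihil v"
  by (simp_all add: annihil_def)

lemma b_creat_vac:
  "j < N \<Longrightarrow> set w \<subseteq> {..<N} \<Longrightarrow> j \<notin> set w \<Longrightarrow> b j * creat w * vac = 0"
proof (induction w)
  case Nil
  then show ?case by (simp add: b_vac)
next
  case (Cons i w)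
  have "b j * creat (i # w) * vac = (b j * a i) * (creat w * vac)"
    by (simp add: mult.assoc)
  also have "b j * a i = - (a i * b j)" using ba[of j i] Cons.prems by simp
  also have "- (a i * b j) * (creat w * vac) = - (a i * (b j * creat w * vac))"
    by (simp add: mult.assoc)
  finally show ?case using Cons by simp
qed

lemma vac_annihil_a:
  "j < N \<Longrightarrow> set w \<subseteq> {..<N} \<Longrightarrow> j \<notin> set w \<Longrightarrow> vac * annihil w * a j = 0"
proof (induction w)
  case Nil
  then show ?case by (simp add: vac_a)
next
  case (Cons i w)
  have "vac * annihil (i # w) * a j = (vac * annihil w) * (b i * a j)"
    by (simp add: mult.assoc)
  also have "b i * a j = - (a j * b i)" using ba[of i j] Cons.prems by simp
  also have "(vac * annihil w) * - (a j * b i) = - (vac * annihil w * a j * b i)"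
    by (simp add: mult.assoc)
  finally show ?case using Cons by simp
qed

text \<open>The leading factors \<open>b\<^sub>i\<close> and \<open>a\<^sub>j\<close> meet in the middle.  If \<open>i = j\<close> they cancel, up to a term
  in which \<open>b\<^sub>i\<close> reaches the vacuum; if not, the one with the smaller index occurs nowhere on the
  other side and reaches the vacuum itself.\<close>

lemma vac_annihil_creat_vac:
  assumes "sorted_wrt (<) v" "sorted_wrt (<) w" "set v \<subseteq> {..<N}" "set w \<subseteq> {..<N}"
  shows "vac * annihil v * creat w * vac = (if v = w then vac else 0)"
  using assms
proof (induction v w rule: list_induct2')
  case 1
  show ?case by (simp add: vac_idem)
next
  case (2 i v)
  then show ?case by (simp add: b_vac mult.assoc)
next
  case (3 j w)
  then show ?case by (simp add: vac_a flip: mult.assoc)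
next
  case (4 i v j w)
  consider "i = j" | "i < j" | "j < i" by linarith
  then show ?case
  proof cases
    case 1
    have 0: "b i * creat w * vac = 0"
      by (rule b_creat_vac) (use 4 1 in auto)
    have "vac * annihil (i # v) * creat (j # w) * vac =
        vac * annihil v * (b i * a i) * creat w * vac"
      using 1 by (simp add: mult.assoc)
    also have "b i * a i = 1 - a i * b i"
      using ba[of i i] 4 by simp
    also have "vac * annihil v * (1 - a i * b i) * creat w * vac =
        vac * annihil v * creat w * vac - vac * annihil v * a i * (b i * creat w * vac)"
      by (simp add: algebra_simps)
    also have "\<dots> = (if v = w then vac else 0)"
      using 4 0 by simp
    finally show ?thesis using 1 by simp
  next
    case 2
    have "b i * creat (j # w) * vac = 0"
      by (rule b_creat_vac) (use 4 2 in auto)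
    then have "vac * annihil v * (b i * creat (j # w) * vac) = 0" by simp
    with 2 show ?thesis by (simp add: mult.assoc)
  next
    case 3
    have "vac * annihil (i # v) * a j = 0"
      by (rule vac_annihil_a) (use 4 3 in auto)
    then have "vac * annihil (i # v) * a j * (creat w * vac) = 0" by simp
    with 3 show ?thesis by (simp add: mult.assoc)
  qed
qed

lemma entries_simps [simp]: "entries 0 I = []"
  "entries (Suc m) I = entries m I @ (if m \<in> I then [m] else [])"
  by (simp_all add: entries_def)

lemma set_entries: "I \<subseteq> {..<m} \<Longrightarrow> set (entries m I) = I"
  by (auto simp: entries_def)

lemma sorted_entries: "sorted_wrt (<) (entries m I)"
  unfolding entries_def by (rule sorted_wrt_filter) simp

lemma distinct_entries: "distinct (entries m I)"
  by (simp add: entries_def)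

lemma length_entries: "I \<subseteq> {..<m} \<Longrightarrow> length (entries m I) = card I"
  using distinct_card[OF distinct_entries, of m I] by (simp add: set_entries)

lemma entries_cong: "(\<And>i. i < m \<Longrightarrow> i \<in> I \<longleftrightarrow> i \<in> J) \<Longrightarrow> entries m I = entries m J"
  unfolding entries_def by (rule filter_cong) auto

text \<open>Inserting \<open>1 = b\<^sub>m a\<^sub>m + a\<^sub>m b\<^sub>m\<close> for one index after another resolves the identity.\<close>

lemma resolution_of_identity_below:
  "m \<le> N \<Longrightarrow> (\<Sum>I\<in>Pow {..<m}. creat (entries m I) * vac_below m * annihil (entries m I)) = 1"
proof (induction m)
  case (Suc m)
  let ?f = "\<lambda>m I. creat (entries m I) * vac_below m * annihil (entries m I)"
  let ?A = "Pow {..<m}" and ?B = "insert m ` Pow {..<m}"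
  (* 1 = b m * a m + a m * b m, and in a m * b m = a m * (b m * a m) * b m the first factor
     commutes with vac_below m *)
  have split: "vac_below m = vac_below (Suc m) + a m * vac_below (Suc m) * b m"
  proof -
    have "a m * vac_below (Suc m) * b m = vac_below m * (a m * b m * a m) * b m"
      using a_commute_vac_below[of m m] Suc.prems by (simp flip: mult.assoc)
    also have "\<dots> = vac_below m * (a m * b m)"
      using aba[of m] Suc.prems by (simp add: mult.assoc)
    also have "a m * b m = 1 - b m * a m"
      using ba[of m m] Suc.prems by simp
    finally show ?thesis by (simp add: right_diff_distrib)
  qed
  have inj: "inj_on (insert m) ?A"
    by (rule inj_onI) (metis Diff_insert_absorb PowD lessThan_iff less_irrefl subsetD)
  have disj: "?A \<inter> ?B = {}" by auto
  have ins: "entries (Suc m) (insert m I) = entries m I @ [m]" for I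
    using entries_cong[of m "insert m I" I] by simp
  have notin: "entries (Suc m) I = entries m I" if "I \<in> ?A" for I
    using that by auto
  have "{..<Suc m} = insert m {..<m}" by auto
  then have "(\<Sum>I\<in>Pow {..<Suc m}. ?f (Suc m) I) = (\<Sum>I\<in>?A. ?f (Suc m) I) + (\<Sum>I\<in>?B. ?f (Suc m) I)"
    by (simp only: Pow_insert) (intro sum.union_disjoint disj, auto)
  also have "(\<Sum>I\<in>?B. ?f (Suc m) I) = (\<Sum>I\<in>?A. ?f (Suc m) (insert m I))"
    by (simp add: sum.reindex[OF inj])
  also have "(\<Sum>I\<in>?A. ?f (Suc m) I) + \<dots> = (\<Sum>I\<in>?A. ?f m I)"
    unfolding sum.distrib[symmetric]
  proof (rule sum.cong[OF refl])
    fix I assume I: "I \<in> ?A"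
    show "?f (Suc m) I + ?f (Suc m) (insert m I) = ?f m I"
      unfolding ins notin[OF I] using arg_cong[OF split, of "\<lambda>x. creat (entries m I) * x * annihil (entries m I)"]
      by (simp add: distrib_left distrib_right mult.assoc del: vac_below.simps)
  qed
  finally show ?case using Suc by simp
qed simp

definition matrix_unit :: "nat set \<Rightarrow> nat set \<Rightarrow> 'c" where
  "matrix_unit I J = creat (entries N I) * vac * annihil (entries N J)"

lemma resolution_of_identity: "(\<Sum>I\<in>Pow {..<N}. matrix_unit I I) = 1"
  using resolution_of_identity_below[of N] by (simp add: matrix_unit_def vac_def)

lemma entries_inject: "I \<subseteq> {..<N} \<Longrightarrow> J \<subseteq> {..<N} \<Longrightarrow> entries N I = entries N J \<longleftrightarrow> I = J"
  by (metis set_entries)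

lemma vac_annihil_creat_entries_vac:
  assumes "I \<subseteq> {..<N}" "J \<subseteq> {..<N}"
  shows "vac * annihil (entries N I) * creat (entries N J) * vac = (if I = J then vac else 0)"
  using vac_annihil_creat_vac[of "entries N I" "entries N J"] assms
  by (simp add: sorted_entries set_entries entries_inject)

lemma unit_creat_vac:
  assumes "J \<subseteq> {..<N}" "K \<subseteq> {..<N}"
  shows "matrix_unit I J * (creat (entries N K) * vac) = (if J = K then creat (entries N I) * vac else 0)"
proof -
  have "matrix_unit I J * (creat (entries N K) * vac) =
      creat (entries N I) * (vac * annihil (entries N J) * creat (entries N K) * vac)"
    by (simp add: matrix_unit_def mult.assoc)
  then show ?thesis using vac_annihil_creat_entries_vac[OF assms] by simp
qed

text \<open>Multiplying by the resolution of the identity on both sides turns an element into the matrix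
  of its vacuum expectations.\<close>

lemma matrix_expansion:
  "c = (\<Sum>I\<in>Pow {..<N}. \<Sum>J\<in>Pow {..<N}. creat (entries N I) *
     (vac * (annihil (entries N I) * c * creat (entries N J)) * vac) * annihil (entries N J))"
proof -
  have "c = (\<Sum>I\<in>Pow {..<N}. matrix_unit I I) * c * (\<Sum>J\<in>Pow {..<N}. matrix_unit J J)"
    by (simp add: resolution_of_identity)
  then show ?thesis
    by (simp add: sum_distrib_left sum_distrib_right matrix_unit_def mult.assoc)
      (erule trans[OF _ sum.swap])
qed

end


section \<open>Exterior algebra: augmentation and contractions\<close>

lemma sum_off_diagonal:
  fixes f :: "nat \<Rightarrow> nat \<Rightarrow> 'v::comm_monoid_add"
  assumes "\<And>i. f i i = 0"
  shows "(\<Sum>j<n. \<Sum>i<n. f i j) = (\<Sum>j<n. \<Sum>i<j. f i j + f j i)"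
  by (induction n) (simp_all add: sum.distrib assms ac_simps)

lemma nths_Cons_delete:
  "nths (x # xs) (- {0}) = xs" "nths (x # xs) (- {Suc k}) = x # nths xs (- {k})"
  "nths (x # xs) (- {0, Suc k}) = nths xs (- {k})"
  "nths (x # xs) (- {Suc k, Suc l}) = x # nths xs (- {k, l})"
proof -
  have "{j. Suc j \<in> - {0}} = UNIV" "{j. Suc j \<in> - {Suc k}} = - {k}"
    "{j. Suc j \<in> - {0, Suc k}} = - {k}" "{j. Suc j \<in> - {Suc k, Suc l}} = - {k, l}"
    by auto
  then show "nths (x # xs) (- {0}) = xs" "nths (x # xs) (- {Suc k}) = x # nths xs (- {k})"
    "nths (x # xs) (- {0, Suc k}) = nths xs (- {k})"
    "nths (x # xs) (- {Suc k, Suc l}) = x # nths xs (- {k, l})"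
    by (simp_all add: nths_Cons nths_all)
qed

lemma wedge_Nil [simp]: "wedge iL [] = 1"
  by (simp add: wedge_def)

lemma wedge_Cons [simp]: "wedge iL (x # xs) = iL x * wedge iL xs"
  by (simp add: wedge_def)

locale based_lie_algebra = lie_algebra sg br
  for sg :: "'k::field \<Rightarrow> 'g::ab_group_add \<Rightarrow> 'g" and br :: "'g \<Rightarrow> 'g \<Rightarrow> 'g" +
  fixes N :: nat and e :: "nat \<Rightarrow> 'g"
  assumes basis: "linear_basis sg N e"
begin

abbreviation dual :: "nat \<Rightarrow> 'g \<Rightarrow> 'k" where "dual i \<equiv> dual_basis sg N e i"

lemma
  shows e_inj: "inj_on e {..<N}" and e_indep: "independent (e ` {..<N})"
    and e_span: "x \<in> span (e ` {..<N})"
  using basis by (auto simp: linear_basis_def)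

lemma br_zero_left [simp]: "br 0 y = 0" and br_zero_right [simp]: "br y 0 = 0"
  using br_add_left[of 0 0 y] br_add_right[of y 0 0] by simp_all

lemma br_anticommute: "br x y = - br y x"
proof -
  have "br (x + y) (x + y) = br x x + br x y + (br y x + br y y)"
    by (simp add: br_add_left br_add_right ac_simps)
  then have "br x y + br y x = 0" by (simp add: br_self)
  then show ?thesis by (simp only: eq_neg_iff_add_eq_0)
qed

lemma br_minus_right: "br x (- y) = - br x y"
  using br_add_right[of x y "- y"] by (simp add: eq_neg_iff_add_eq_0 add.commute)

lemma br_br: "br x (br y z) - br y (br x z) = br (br x y) z"
proof -
  have "br y (br z x) = - br y (br x z)" and "br z (br x y) = - br (br x y) z"
    using br_anticommute[of z x] br_anticommute[of z "br x y"] by (simp_all add: br_minus_right)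
  then show ?thesis
    using jacobi[of x y z] by (simp add: algebra_simps)
qed

lemma br_sum_left: "br (sum f I) y = (\<Sum>i\<in>I. br (f i) y)"
  by (induction I rule: infinite_finite_induct) (simp_all add: br_add_left)

lemma basis_expansion: "x = (\<Sum>i<N. sg (dual i x) (e i))"
proof -
  have "x = (\<Sum>v\<in>e ` {..<N}. sg (representation (e ` {..<N}) x v) v)"
    by (rule sum_representation_eq[symmetric]) (use e_indep e_span in auto)
  then show ?thesis
    by (simp add: sum.reindex[OF e_inj] dual_basis_def)
qed

lemma dual_e: "i < N \<Longrightarrow> j < N \<Longrightarrow> dual i (e j) = (if i = j then 1 else 0)"
  using representation_basis[OF e_indep, of "e j"] e_inj
  by (auto simp: dual_basis_def inj_on_def)

lemma dual_space_iff:
  "\<xi> \<in> dual_space sg \<longleftrightarrow> (\<forall>x y. \<xi> (x + y) = \<xi> x + \<xi> y) \<and> (\<forall>c x. \<xi> (sg c x) = c * \<xi> x)"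
proof -
  have "vector_space ((*) :: 'k \<Rightarrow> 'k \<Rightarrow> 'k)"
    by unfold_locales (simp_all add: algebra_simps)
  then show ?thesis
    using vector_space_axioms
    by (auto simp: dual_space_def Vector_Spaces.linear_iff)
qed

lemma dual_in_dual_space: "dual i \<in> dual_space sg"
  using e_indep e_span
  by (auto simp: dual_space_iff dual_basis_def representation_add representation_scale)

lemma dual_space_add: "\<xi> \<in> dual_space sg \<Longrightarrow> \<eta> \<in> dual_space sg \<Longrightarrow> (\<lambda>v. \<xi> v + \<eta> v) \<in> dual_space sg"
  and dual_space_scale: "\<xi> \<in> dual_space sg \<Longrightarrow> (\<lambda>v. c * \<xi> v) \<in> dual_space sg"
  and dual_space_zero: "(\<lambda>v. 0) \<in> dual_space sg"
  by (auto simp: dual_space_iff algebra_simps)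

lemma functional_sum: "\<xi> \<in> dual_space sg \<Longrightarrow> \<xi> (sum f I) = (\<Sum>i\<in>I. \<xi> (f i))"
proof -
  assume xi: "\<xi> \<in> dual_space sg"
  then have "additive \<xi>" by (simp add: additive_def dual_space_iff)
  then show ?thesis by (rule additive.sum)
qed

lemma dual_expansion: "\<xi> \<in> dual_space sg \<Longrightarrow> \<xi> = (\<lambda>v. \<Sum>i<N. \<xi> (e i) * dual i v)"
proof
  fix v
  assume xi: "\<xi> \<in> dual_space sg"
  have "\<xi> v = \<xi> (\<Sum>i<N. sg (dual i v) (e i))"
    using basis_expansion[of v] by simp
  then show "\<xi> v = (\<Sum>i<N. \<xi> (e i) * dual i v)"
    using xi by (simp add: functional_sum) (simp add: dual_space_iff mult.commute)
qed

end

locale exterior = based_lie_algebra sg br N e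
  for sg :: "'k::field \<Rightarrow> 'g::ab_group_add \<Rightarrow> 'g" and br :: "'g \<Rightarrow> 'g \<Rightarrow> 'g"
    and N :: nat and e :: "nat \<Rightarrow> 'g" +
  fixes sL :: "'k \<Rightarrow> 'l::ring_1 \<Rightarrow> 'l" and iL :: "'g \<Rightarrow> 'l"
  assumes L: "exterior_algebra sg sL iL"
begin

lemma presented_L:
  "presented_algebra sL UNIV (linearity_rels sg id \<union> {fgen x * fgen x | x. True}) iL"
  using L by (simp add: exterior_algebra_def)

sublocale L: assoc_algebra sL
  using presented_L by (simp add: presented_algebra_def)

lemma
  shows iL_add: "iL (x + y) = iL x + iL y"
    and iL_scale: "iL (sg c x) = sL c (iL x)"
    and iL_sq: "iL x * iL x = 0"
proof -
  let ?R = "linearity_rels sg id \<union> {fgen x * fgen x | x. True} :: ('g, 'k) free_alg set"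
  obtain F where F: "free_algebra_map sL UNIV iL F" "\<And>r. r \<in> ?R \<Longrightarrow> F r = 0"
    using presented_algebra_relations[OF presented_L] by blast
  note F_simps = free_algebra_map_simps[OF F(1)]
  have "F (fgen (id (x + y)) - fgen (id x) - fgen (id y)) = 0"
    by (rule F(2)) (unfold linearity_rels_def, blast)
  then show "iL (x + y) = iL x + iL y" by (simp add: F_simps diff_diff_eq)
  have "F (fgen (id (sg c x)) - fconst c * fgen (id x)) = 0"
    by (rule F(2)) (unfold linearity_rels_def, blast)
  then show "iL (sg c x) = sL c (iL x)" by (simp add: F_simps L.scale_mult_left)
  have "F (fgen x * fgen x) = 0"
    by (rule F(2)) blast
  then show "iL x * iL x = 0" by (simp add: F_simps)
qed

lemma iL_sq_mult: "iL x * (iL x * l) = 0"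
  by (simp add: iL_sq flip: mult.assoc)

lemma iL_anticommute: "iL x * iL y = - (iL y * iL x)"
proof -
  have "iL (x + y) * iL (x + y) = iL x * iL y + iL y * iL x"
    by (simp only: iL_add distrib_left distrib_right iL_sq) simp
  then show ?thesis by (simp add: iL_sq eq_neg_iff_add_eq_0)
qed

lemma iL_zero [simp]: "iL 0 = 0"
  using iL_add[of 0 0] by simp

lemma iL_minus: "iL (- x) = - iL x"
  using iL_add[of x "- x"] by (simp add: eq_neg_iff_add_eq_0 add.commute)

lemma iL_sum: "iL (sum f I) = (\<Sum>i\<in>I. iL (f i))"
  by (induction I rule: infinite_finite_induct) (simp_all add: iL_add)

lemmas exterior_induct [case_names one mult add scale] =
  presented_algebra_induct[OF presented_L, simplified]

text \<open>The augmentation reads off the component of degree 0.  It comes from letting every vector act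
  by \<open>0\<close> on the ground field.\<close>

definition is_augmentation :: "('l \<Rightarrow> 'k) \<Rightarrow> bool" where
  "is_augmentation f \<longleftrightarrow> (\<forall>l l'. f (l + l') = f l + f l') \<and> (\<forall>c l. f (sL c l) = c * f l) \<and> f 1 = 1 \<and>
     (\<forall>x l. f (iL x * l) = 0)"

lemma augmentation_exists: "\<exists>f. is_augmentation f"
proof -
  interpret T: operator_family "(*) :: 'k \<Rightarrow> 'k \<Rightarrow> 'k" "\<lambda>(x::'g) _. 0"
    by unfold_locales (simp_all add: algebra_simps)
  have rels: "word_action (*) (\<lambda>x _. 0) r m = 0"
    if "r \<in> linearity_rels sg id \<union> {fgen x * fgen x | x. True}" for r :: "('g, 'k) free_alg" and m
    using that by (auto simp: linearity_rels_def T.word_action_simps)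
  obtain \<rho> where \<rho>: "algebra_action sL (*) \<rho>" "\<And>x m. \<rho> (iL x) m = 0"
    using presented_algebra_action[OF presented_L T.operator_family_axioms rels] by blast
  show ?thesis
    by (rule exI[of _ "\<lambda>l. \<rho> l 1"]) (simp add: is_augmentation_def \<rho>(2) algebra_action_simps[OF \<rho>(1)])
qed

definition eps :: "'l \<Rightarrow> 'k" where "eps = (SOME f. is_augmentation f)"

lemma
  shows eps_add: "eps (l + l') = eps l + eps l'" and eps_scale: "eps (sL c l) = c * eps l"
    and eps_one: "eps 1 = 1" and eps_mult: "eps (iL x * l) = 0"
proof -
  have "is_augmentation eps"
    unfolding eps_def by (rule someI_ex[OF augmentation_exists])
  then show "eps (l + l') = eps l + eps l'" "eps (sL c l) = c * eps l" "eps 1 = 1"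
    "eps (iL x * l) = 0"
    by (simp_all add: is_augmentation_def)
qed

lemma eps_zero [simp]: "eps 0 = 0"
  using eps_scale[of 0 0] by simp

lemma eps_wedge: "xs \<noteq> [] \<Longrightarrow> eps (wedge iL xs) = 0"
  by (cases xs) (simp_all add: eps_mult)

text \<open>Contraction by \<open>\<xi>\<close> is the off-diagonal entry of the representation of the exterior algebra
  by triangular matrices with rows \<open>(- x, \<xi> x)\<close> and \<open>(0, x)\<close>, which square to zero.\<close>

definition is_contraction :: "('g \<Rightarrow> 'k) \<Rightarrow> ('l \<Rightarrow> 'l) \<Rightarrow> bool" where
  "is_contraction \<xi> f \<longleftrightarrow> (\<forall>l l'. f (l + l') = f l + f l') \<and> (\<forall>c l. f (sL c l) = sL c (f l)) \<and>
     f 1 = 0 \<and> (\<forall>x l. f (iL x * l) = sL (\<xi> x) l - iL x * f l)"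

lemma contraction_exists:
  assumes \<xi>: "\<xi> \<in> dual_space sg"
  shows "\<exists>f. is_contraction \<xi> f"
proof -
  define sM :: "'k \<Rightarrow> 'l \<times> 'l \<Rightarrow> 'l \<times> 'l" where "sM c p = (sL c (fst p), sL c (snd p))" for c p
  define T :: "'g \<Rightarrow> 'l \<times> 'l \<Rightarrow> 'l \<times> 'l"
    where "T x p = (sL (\<xi> x) (snd p) - iL x * fst p, iL x * snd p)" for x p
  interpret T: operator_family sM T
    by unfold_locales
      (simp_all add: sM_def T_def prod_eq_iff L.scale_right_distrib L.scale_left_distrib
        distrib_left L.scale_mult_right L.scale_right_diff_distrib mult.commute)
  have lin: "\<xi> (x + y) = \<xi> x + \<xi> y" "\<xi> (sg c x) = c * \<xi> x" for x y c
    using \<xi> by (simp_all add: dual_space_iff)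
  have rels: "word_action sM T r m = 0"
    if "r \<in> linearity_rels sg id \<union> {fgen x * fgen x | x. True}" for r :: "('g, 'k) free_alg" and m
    using that
    by (auto simp: linearity_rels_def T.word_action_simps sM_def T_def prod_eq_iff lin iL_add iL_scale
        L.scale_left_distrib distrib_right L.scale_mult_left L.scale_mult_right iL_sq_mult
        right_diff_distrib L.scale_right_diff_distrib)
  obtain \<rho> where \<rho>: "algebra_action sL sM \<rho>" "\<And>x m. \<rho> (iL x) m = T x m"
    using presented_algebra_action[OF presented_L T.operator_family_axioms rels] by blast
  have snd: "snd (\<rho> l (0, 1)) = l" for l
    by (induction l rule: exterior_induct) (simp_all add: algebra_action_simps[OF \<rho>(1)] \<rho>(2) T_def sM_def)
  show ?thesis
    by (rule exI[of _ "\<lambda>l. fst (\<rho> l (0, 1))"])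
      (simp add: is_contraction_def algebra_action_simps[OF \<rho>(1)] \<rho>(2) snd T_def sM_def)
qed

text \<open>The value \<open>0\<close> for maps that are not linear functionals makes every \<open>contr \<xi>\<close> linear, so that
  the operators can be fed to the universal property without side conditions.\<close>

definition contr :: "('g \<Rightarrow> 'k) \<Rightarrow> 'l \<Rightarrow> 'l" where
  "contr \<xi> = (if \<xi> \<in> dual_space sg then SOME f. is_contraction \<xi> f else (\<lambda>l. 0))"

lemma contr_spec: "\<xi> \<in> dual_space sg \<Longrightarrow> is_contraction \<xi> (contr \<xi>)"
  using someI_ex[OF contraction_exists] by (simp add: contr_def)

lemma contr_add: "contr \<xi> (l + l') = contr \<xi> l + contr \<xi> l'"
  and contr_scale: "contr \<xi> (sL c l) = sL c (contr \<xi> l)"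
  and contr_one [simp]: "contr \<xi> 1 = 0"
  using contr_spec[of \<xi>]
  by (cases "\<xi> \<in> dual_space sg", auto simp: is_contraction_def) (auto simp: contr_def)

lemma contr_mult: "\<xi> \<in> dual_space sg \<Longrightarrow> contr \<xi> (iL x * l) = sL (\<xi> x) l - iL x * contr \<xi> l"
  using contr_spec by (auto simp: is_contraction_def)

lemma additive_contr: "additive (contr \<xi>)"
  by (simp add: additive_def contr_add)

lemmas contr_zero [simp] = additive.zero[OF additive_contr]
lemmas contr_diff = additive.diff[OF additive_contr]

lemma contr_functional_add:
  assumes "\<xi> \<in> dual_space sg" "\<eta> \<in> dual_space sg"
  shows "contr (\<lambda>v. \<xi> v + \<eta> v) l = contr \<xi> l + contr \<eta> l"
  by (induction l rule: exterior_induct)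
    (simp_all add: assms contr_mult contr_add contr_scale dual_space_add algebra_simps
      L.scale_left_distrib L.scale_right_distrib)

lemma contr_functional_scale:
  assumes "\<xi> \<in> dual_space sg"
  shows "contr (\<lambda>v. c * \<xi> v) l = sL c (contr \<xi> l)"
  by (induction l rule: exterior_induct)
    (simp_all add: assms contr_mult contr_add contr_scale dual_space_scale algebra_simps
      L.scale_right_distrib L.scale_right_diff_distrib L.scale_mult_right)

lemma contr_contr_mult:
  assumes "\<xi> \<in> dual_space sg" "\<eta> \<in> dual_space sg"
  shows "contr \<xi> (contr \<eta> (iL x * l)) =
    sL (\<eta> x) (contr \<xi> l) - sL (\<xi> x) (contr \<eta> l) + iL x * contr \<xi> (contr \<eta> l)"
  by (simp add: assms contr_mult contr_diff contr_scale)

lemma contr_anticommute: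
  assumes "\<xi> \<in> dual_space sg" "\<eta> \<in> dual_space sg"
  shows "contr \<xi> (contr \<eta> l) + contr \<eta> (contr \<xi> l) = 0"
proof (induction l rule: exterior_induct)
  case (mult x l)
  have "contr \<xi> (contr \<eta> (iL x * l)) + contr \<eta> (contr \<xi> (iL x * l)) =
      iL x * (contr \<xi> (contr \<eta> l) + contr \<eta> (contr \<xi> l))"
    by (simp add: contr_contr_mult assms algebra_simps)
  with mult show ?case by simp
next
  case (add l l')
  have "contr \<xi> (contr \<eta> (l + l')) + contr \<eta> (contr \<xi> (l + l')) =
      (contr \<xi> (contr \<eta> l) + contr \<eta> (contr \<xi> l)) + (contr \<xi> (contr \<eta> l') + contr \<eta> (contr \<xi> l'))"
    by (simp add: contr_add algebra_simps)
  with add show ?case by simp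
next
  case (scale k l)
  then show ?case by (simp add: contr_scale flip: L.scale_right_distrib)
qed simp

lemma contr_contr_self:
  assumes "\<xi> \<in> dual_space sg"
  shows "contr \<xi> (contr \<xi> l) = 0"
  by (induction l rule: exterior_induct)
    (simp_all add: contr_contr_mult assms contr_add contr_scale)

text \<open>\<open>bracket_contr\<close> is the action of the second sum of the BRST element, and \<open>adjoint x\<close> is the
  derivation of the exterior algebra that extends \<open>br x\<close>.\<close>

definition bracket_contr :: "'l \<Rightarrow> 'l" where
  "bracket_contr l = (\<Sum>j<N. \<Sum>i<j. iL (br (e i) (e j)) * contr (dual i) (contr (dual j) l))"

definition adjoint :: "'g \<Rightarrow> 'l \<Rightarrow> 'l" where
  "adjoint x l = (\<Sum>j<N. iL (br x (e j)) * contr (dual j) l)"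

lemma additive_bracket_contr: "additive bracket_contr" and additive_adjoint: "additive (adjoint x)"
  by (auto simp: additive_def bracket_contr_def adjoint_def contr_add distrib_left sum.distrib)

lemma bracket_contr_scale: "bracket_contr (sL c l) = sL c (bracket_contr l)"
  by (simp add: bracket_contr_def contr_scale L.scale_mult_right L.scale_sum_right)

lemma adjoint_scale: "adjoint x (sL c l) = sL c (adjoint x l)"
  by (simp add: adjoint_def contr_scale L.scale_mult_right L.scale_sum_right)

lemma bracket_contr_one [simp]: "bracket_contr 1 = 0" and adjoint_one [simp]: "adjoint x 1 = 0"
  by (simp_all add: bracket_contr_def adjoint_def)

lemma iL_br_basis_sum: "(\<Sum>j<N. sL (dual j y) (iL (br x (e j)))) = iL (br x y)"
proof -
  have "br x y = - br y x" by (rule br_anticommute)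
  also have "br y x = (\<Sum>j<N. br (sg (dual j y) (e j)) x)"
    by (subst basis_expansion[of y]) (simp add: br_sum_left)
  also have "- \<dots> = (\<Sum>j<N. sg (dual j y) (br x (e j)))"
    by (simp add: br_scale_left br_anticommute[of "e _" x] sum_negf)
  finally show ?thesis by (simp add: iL_sum iL_scale)
qed

lemma adjoint_mult: "adjoint x (iL y * l) = iL (br x y) * l + iL y * adjoint x l"
proof -
  have "adjoint x (iL y * l) = (\<Sum>j<N. sL (dual j y) (iL (br x (e j)) * l) + iL y * (iL (br x (e j)) * contr (dual j) l))"
    unfolding adjoint_def
  proof (rule sum.cong[OF refl])
    fix j
    show "iL (br x (e j)) * contr (dual j) (iL y * l) =
      sL (dual j y) (iL (br x (e j)) * l) + iL y * (iL (br x (e j)) * contr (dual j) l)"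
      using iL_anticommute[of "br x (e j)" y]
      by (simp add: contr_mult dual_in_dual_space right_diff_distrib L.scale_mult_right flip: mult.assoc)
  qed
  also have "\<dots> = (\<Sum>j<N. sL (dual j y) (iL (br x (e j)))) * l + iL y * adjoint x l"
    by (simp add: sum.distrib sum_distrib_right L.scale_mult_left adjoint_def sum_distrib_left)
  finally show ?thesis by (simp only: iL_br_basis_sum)
qed

text \<open>The anticommutator of \<open>bracket_contr\<close> with multiplication by \<open>x\<close> is \<open>- adjoint x\<close>.  This
  reduces both the explicit formula on products and the vanishing of the square of the differential
  to inductions on the number of factors.  The terms linear in the coordinates of \<open>x\<close> are a sum over
  \<open>i < j\<close>, which is symmetrised to a sum over all pairs because brackets are alternating.\<close>

lemma bracket_contr_mult: "bracket_contr (iL x * l) = - (iL x * bracket_contr l) - adjoint x l"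
proof -
  define f where "f i j = sL (dual i x) (iL (br (e i) (e j)) * contr (dual j) l)" for i j
  have summand: "iL (br (e i) (e j)) * contr (dual i) (contr (dual j) (iL x * l)) =
      - (f i j + f j i) - iL x * (iL (br (e i) (e j)) * contr (dual i) (contr (dual j) l))" for i j
  proof -
    have "f j i = - sL (dual j x) (iL (br (e i) (e j)) * contr (dual i) l)"
      unfolding f_def by (subst br_anticommute) (simp add: iL_minus)
    moreover have "iL (br (e i) (e j)) * (iL x * m) = - (iL x * (iL (br (e i) (e j)) * m))" for m
      using iL_anticommute[of "br (e i) (e j)" x] by (simp flip: mult.assoc)
    ultimately show ?thesis
      by (simp add: f_def contr_contr_mult dual_in_dual_space distrib_left right_diff_distrib
          L.scale_mult_right)
  qed
  have "adjoint x l = (\<Sum>j<N. \<Sum>i<N. f i j)"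
    unfolding adjoint_def
  proof (rule sum.cong[OF refl])
    fix j
    have "br x (e j) = (\<Sum>i<N. sg (dual i x) (br (e i) (e j)))"
      by (subst basis_expansion[of x]) (simp add: br_sum_left br_scale_left)
    then show "iL (br x (e j)) * contr (dual j) l = (\<Sum>i<N. f i j)"
      by (simp add: f_def iL_sum iL_scale sum_distrib_right L.scale_mult_left)
  qed
  also have "\<dots> = (\<Sum>j<N. \<Sum>i<j. f i j + f j i)"
    by (rule sum_off_diagonal) (simp add: f_def br_self)
  finally show ?thesis
    unfolding bracket_contr_def
    by (simp only: summand) (simp add: sum_subtractf sum_negf sum_distrib_left sum.distrib)
qed

text \<open>The explicit formulas with omitted entries, which have the shape of the terms of the
  differential of the standard resolution.\<close>

lemma contr_wedge:
  assumes "\<xi> \<in> dual_space sg"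
  shows "contr \<xi> (wedge iL xs) =
    (\<Sum>k<length xs. sL (\<xi> (xs ! k)) ((- 1) ^ k * wedge iL (nths xs (- {k}))))"
proof (induction xs)
  case (Cons x xs)
  have "iL x * ((- 1) ^ k * m) = - ((- 1) ^ Suc k * (iL x * m))" for k m
    by (cases "even k") simp_all
  then show ?case
    using Cons
    by (simp add: sum.lessThan_Suc_shift nths_Cons_delete contr_mult assms sum_distrib_left
        L.scale_mult_right sum_negf del: sum.lessThan_Suc)
qed simp

lemma adjoint_wedge:
  "adjoint x (wedge iL xs) =
    (\<Sum>k<length xs. (- 1) ^ k * (iL (br x (xs ! k)) * wedge iL (nths xs (- {k}))))"
proof (induction xs)
  case (Cons y xs)
  have "iL y * ((- 1) ^ k * (iL z * m)) = (- 1) ^ Suc k * (iL z * (iL y * m))" for k z m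
    using iL_anticommute[of y z] by (cases "even k") (simp_all flip: mult.assoc)
  then show ?case
    using Cons
    by (simp add: sum.lessThan_Suc_shift nths_Cons_delete adjoint_mult sum_distrib_left
        del: sum.lessThan_Suc)
qed simp

lemma bracket_contr_wedge:
  "bracket_contr (wedge iL xs) = (\<Sum>j<length xs. \<Sum>i<j.
     (- 1) ^ (i + j) * (iL (br (xs ! i) (xs ! j)) * wedge iL (nths xs (- {i, j}))))"
proof (induction xs)
  case (Cons x xs)
  have comm: "iL x * ((- 1) ^ k * (iL z * m)) = - ((- 1) ^ k * (iL z * (iL x * m)))" for k z m
    using iL_anticommute[of x z] by (cases "even k") (simp_all flip: mult.assoc)
  show ?case
    using Cons
    by (simp add: sum.lessThan_Suc_shift nths_Cons_delete bracket_contr_mult adjoint_wedge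
        sum_distrib_left comm sum_negf sum.distrib sum_subtractf del: sum.lessThan_Suc)
qed simp

end


section \<open>The Clifford algebra acting on the exterior algebra\<close>

locale clifford = exterior sg br N e sL iL
  for sg :: "'k::field \<Rightarrow> 'g::ab_group_add \<Rightarrow> 'g" and br :: "'g \<Rightarrow> 'g \<Rightarrow> 'g"
    and N :: nat and e :: "nat \<Rightarrow> 'g"
    and sL :: "'k \<Rightarrow> 'l::ring_1 \<Rightarrow> 'l" and iL :: "'g \<Rightarrow> 'l" +
  fixes sC :: "'k \<Rightarrow> 'c::ring_1 \<Rightarrow> 'c" and iC :: "'g + ('g \<Rightarrow> 'k) \<Rightarrow> 'c"
  assumes C: "clifford_algebra sg sC iC"
begin

lemma presented_C: "presented_algebra sC (clifford_gens sg) (clifford_rels sg) iC"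
  using C by (simp add: clifford_algebra_def)

sublocale C: assoc_algebra sC
  using presented_C by (simp add: presented_algebra_def)

abbreviation vec :: "'g \<Rightarrow> 'c" where "vec x \<equiv> iC (Inl x)"
abbreviation cov :: "('g \<Rightarrow> 'k) \<Rightarrow> 'c" where "cov \<xi> \<equiv> iC (Inr \<xi>)"

lemma gens_Inl [simp]: "Inl x \<in> clifford_gens sg"
  and gens_Inr [simp]: "Inr \<xi> \<in> clifford_gens sg \<longleftrightarrow> \<xi> \<in> dual_space sg"
  by (auto simp: clifford_gens_def)

lemma
  shows vec_add: "vec (x + y) = vec x + vec y"
    and vec_scale: "vec (sg c x) = sC c (vec x)"
    and vec_anticommute: "vec x * vec y = - (vec y * vec x)"
    and vec_sq: "vec x * vec x = 0"
    and cov_add: "\<xi> \<in> dual_space sg \<Longrightarrow> \<eta> \<in> dual_space sg \<Longrightarrow> cov (\<lambda>v. \<xi> v + \<eta> v) = cov \<xi> + cov \<eta>"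
    and cov_scale: "\<xi> \<in> dual_space sg \<Longrightarrow> cov (\<lambda>v. c * \<xi> v) = sC c (cov \<xi>)"
    and cov_anticommute: "\<xi> \<in> dual_space sg \<Longrightarrow> \<eta> \<in> dual_space sg \<Longrightarrow> cov \<xi> * cov \<eta> = - (cov \<eta> * cov \<xi>)"
    and cov_sq: "\<xi> \<in> dual_space sg \<Longrightarrow> cov \<xi> * cov \<xi> = 0"
    and cov_vec: "\<xi> \<in> dual_space sg \<Longrightarrow> cov \<xi> * vec x = sC (\<xi> x) 1 - vec x * cov \<xi>"
proof -
  obtain F where F: "free_algebra_map sC (clifford_gens sg) iC F"
    "\<And>r. r \<in> clifford_rels sg \<Longrightarrow> F r = 0"
    using presented_algebra_relations[OF presented_C] by blast
  note F_simps = free_algebra_map_simps[OF F(1)]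
  note mem = clifford_rels_def linearity_rels_def
  have "F (fgen (Inl (x + y)) - fgen (Inl x) - fgen (Inl y)) = 0"
    by (rule F(2)) (unfold mem, blast)
  then show "vec (x + y) = vec x + vec y" by (simp add: F_simps diff_diff_eq)
  have "F (fgen (Inl (sg c x)) - fconst c * fgen (Inl x)) = 0"
    by (rule F(2)) (unfold mem, blast)
  then show "vec (sg c x) = sC c (vec x)" by (simp add: F_simps C.scale_mult_left)
  have "F (fgen (Inl x) * fgen (Inl y) + fgen (Inl y) * fgen (Inl x)) = 0"
    by (rule F(2)) (unfold mem, blast)
  then show "vec x * vec y = - (vec y * vec x)" by (simp add: F_simps eq_neg_iff_add_eq_0)
  have "F (fgen (Inl x) * fgen (Inl x)) = 0"
    by (rule F(2)) (unfold mem, blast)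
  then show "vec x * vec x = 0" by (simp add: F_simps)
  assume xi: "\<xi> \<in> dual_space sg"
  have "F (fgen (Inr (\<lambda>v. c * \<xi> v)) - fconst c * fgen (Inr \<xi>)) = 0"
    by (rule F(2)) (use xi in \<open>unfold mem, blast\<close>)
  with xi show "cov (\<lambda>v. c * \<xi> v) = sC c (cov \<xi>)"
    by (simp add: F_simps C.scale_mult_left dual_space_scale)
  have "F (fgen (Inr \<xi>) * fgen (Inr \<xi>)) = 0"
    by (rule F(2)) (use xi in \<open>unfold mem, blast\<close>)
  with xi show "cov \<xi> * cov \<xi> = 0" by (simp add: F_simps)
  have "F (fgen (Inr \<xi>) * fgen (Inl x) + fgen (Inl x) * fgen (Inr \<xi>) - fconst (\<xi> x)) = 0"
    by (rule F(2)) (use xi in \<open>unfold mem, blast\<close>)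
  with xi show "cov \<xi> * vec x = sC (\<xi> x) 1 - vec x * cov \<xi>"
    by (simp add: F_simps eq_diff_eq)
  assume eta: "\<eta> \<in> dual_space sg"
  have "F (fgen (Inr (\<lambda>v. \<xi> v + \<eta> v)) - fgen (Inr \<xi>) - fgen (Inr \<eta>)) = 0"
    by (rule F(2)) (use xi eta in \<open>unfold mem, blast\<close>)
  with xi eta show "cov (\<lambda>v. \<xi> v + \<eta> v) = cov \<xi> + cov \<eta>"
    by (simp add: F_simps dual_space_add diff_diff_eq)
  have "F (fgen (Inr \<xi>) * fgen (Inr \<eta>) + fgen (Inr \<eta>) * fgen (Inr \<xi>)) = 0"
    by (rule F(2)) (use xi eta in \<open>unfold mem, blast\<close>)
  with xi eta show "cov \<xi> * cov \<eta> = - (cov \<eta> * cov \<xi>)"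
    by (simp add: F_simps eq_neg_iff_add_eq_0)
qed

lemma vec_zero: "vec 0 = 0"
  using vec_add[of 0 0] by simp

lemma vec_sum: "vec (sum f I) = (\<Sum>i\<in>I. vec (f i))"
  by (induction I rule: infinite_finite_induct) (simp_all add: vec_add vec_zero)

lemma vec_expansion: "vec x = (\<Sum>i<N. sC (dual i x) (vec (e i)))"
  by (subst basis_expansion[of x]) (simp add: vec_sum vec_scale)

lemma cov_expansion:
  assumes "\<xi> \<in> dual_space sg"
  shows "cov \<xi> = (\<Sum>i<N. sC (\<xi> (e i)) (cov (dual i)))"
proof -
  have "(\<lambda>v. \<Sum>i<n. \<xi> (e i) * dual i v) \<in> dual_space sg \<and>
      cov (\<lambda>v. \<Sum>i<n. \<xi> (e i) * dual i v) = (\<Sum>i<n. sC (\<xi> (e i)) (cov (dual i)))" for n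
  proof (induction n)
    case 0
    show ?case using cov_scale[OF dual_space_zero, of 0] dual_space_zero by simp
  next
    case (Suc n)
    then show ?case
      by (simp add: cov_add cov_scale dual_space_add dual_space_scale dual_in_dual_space)
  qed
  from this[of N] show ?thesis by (simp flip: dual_expansion[OF assms])
qed

lemma clifford_induct [case_names one vec cov add scale]:
  assumes "P 1" "\<And>x c. P c \<Longrightarrow> P (vec x * c)"
    "\<And>\<xi> c. \<xi> \<in> dual_space sg \<Longrightarrow> P c \<Longrightarrow> P (cov \<xi> * c)"
    "\<And>c c'. P c \<Longrightarrow> P c' \<Longrightarrow> P (c + c')" "\<And>k c. P c \<Longrightarrow> P (sC k c)"
  shows "P c"
proof (rule presented_algebra_induct[OF presented_C])
  show "P (iC x * c)" if "x \<in> clifford_gens sg" "P c" for x c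
    using that assms(2,3) by (auto simp: clifford_gens_def)
qed (use assms in auto)

text \<open>Exterior multiplication and contraction satisfy the relations of the Clifford algebra.\<close>

definition is_spinor_action :: "('c \<Rightarrow> 'l \<Rightarrow> 'l) \<Rightarrow> bool" where
  "is_spinor_action \<rho> \<longleftrightarrow> algebra_action sC sL \<rho> \<and> (\<forall>x l. \<rho> (vec x) l = iL x * l) \<and>
     (\<forall>\<xi>\<in>dual_space sg. \<forall>l. \<rho> (cov \<xi>) l = contr \<xi> l)"

lemma spinor_action_exists: "\<exists>\<rho>. is_spinor_action \<rho>"
proof -
  define T :: "'g + ('g \<Rightarrow> 'k) \<Rightarrow> 'l \<Rightarrow> 'l" where "T = case_sum (\<lambda>x l. iL x * l) contr"
  have T_simps: "T (Inl x) l = iL x * l" "T (Inr \<xi>) l = contr \<xi> l" for x \<xi> l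
    by (simp_all add: T_def)
  interpret T: operator_family sL T
  proof
    show "T y (l + l') = T y l + T y l'" for y l l'
      by (cases y) (simp_all add: T_simps distrib_left contr_add)
    show "T y (sL c l) = sL c (T y l)" for y c l
      by (cases y) (simp_all add: T_simps L.scale_mult_right contr_scale)
  qed
  have anti: "iL x * (iL y * l) + iL y * (iL x * l) = 0" for x y l
    using iL_anticommute[of x y] by (simp flip: mult.assoc)
  have "word_action sL T r m = 0" if "r \<in> clifford_rels sg" for r m
    using that unfolding clifford_rels_def linearity_rels_def
    by (auto simp: T.word_action_simps T_simps iL_add iL_scale distrib_right L.scale_mult_left
        contr_functional_add contr_functional_scale anti iL_sq_mult contr_anticommute
        contr_contr_self contr_mult)
  from presented_algebra_action[OF presented_C T.operator_family_axioms this]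
  obtain \<rho> where \<rho>: "algebra_action sC sL \<rho>" "\<And>y m. y \<in> clifford_gens sg \<Longrightarrow> \<rho> (iC y) m = T y m"
    by blast
  then have "is_spinor_action \<rho>"
    by (simp add: is_spinor_action_def T_simps)
  then show ?thesis by blast
qed

definition act :: "'c \<Rightarrow> 'l \<Rightarrow> 'l" where "act = (SOME \<rho>. is_spinor_action \<rho>)"

lemma is_spinor_action_act: "is_spinor_action act"
  unfolding act_def by (rule someI_ex[OF spinor_action_exists])

lemma algebra_action_act: "algebra_action sC sL act"
  and act_vec: "act (vec x) l = iL x * l"
  and act_cov: "\<xi> \<in> dual_space sg \<Longrightarrow> act (cov \<xi>) l = contr \<xi> l"
  using is_spinor_action_act by (simp_all add: is_spinor_action_def)

lemmas act_simps = algebra_action_simps[OF algebra_action_act]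

lemma additive_act_left: "additive (\<lambda>c. act c l)"
  by (simp add: additive_def act_simps)

lemmas act_zero_left = additive.zero[OF additive_act_left]
  and act_sum_left = additive.sum[OF additive_act_left]

sublocale fermions N "\<lambda>i. vec (e i)" "\<lambda>i. cov (dual i)"
proof
  show "cov (dual i) * vec (e j) = (if i = j then 1 else 0) - vec (e j) * cov (dual i)"
    if "i < N" "j < N" for i j
    using that by (simp add: cov_vec dual_in_dual_space dual_e)
qed (simp_all add: vec_sq cov_sq dual_in_dual_space, (rule vec_anticommute cov_anticommute; simp add: dual_in_dual_space)+)

text \<open>The vacuum idempotent acts as the augmentation: it fixes \<open>1\<close>, and annihilates products with a
  vector factor because \<open>vac * vec x = 0\<close>.\<close>

lemma vac_vec: "vac * vec x = 0"
  by (subst vec_expansion) (simp add: sum_distrib_left C.scale_mult_right vac_a)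

lemma cov_vac: "\<xi> \<in> dual_space sg \<Longrightarrow> cov \<xi> * vac = 0"
  by (subst cov_expansion) (simp_all add: sum_distrib_right C.scale_mult_left b_vac)

lemma act_vac_one: "act vac 1 = 1"
proof -
  have "m \<le> N \<Longrightarrow> act (vac_below m) 1 = 1" for m
  proof (induction m)
    case (Suc m)
    have "contr (dual m) (iL (e m) * 1) = 1"
      using Suc.prems by (simp only: contr_mult dual_in_dual_space) (simp add: dual_e)
    with Suc show ?case by (simp add: act_simps act_vec act_cov dual_in_dual_space)
  qed (simp add: act_simps)
  then show ?thesis by (simp add: vac_def)
qed

lemma act_vac: "act vac l = sL (eps l) 1"
proof (induction l rule: exterior_induct)
  case (mult x l)
  have "act vac (iL x * l) = act (vac * vec x) l" by (simp add: act_simps act_vec)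
  then show ?case by (simp add: vac_vec act_zero_left eps_mult)
qed (simp_all add: act_vac_one eps_one act_simps eps_add eps_scale L.scale_left_distrib)

text \<open>Vacuum expectations are scalars, because the left ideal generated by the vacuum is spanned by
  products of vectors times the vacuum.\<close>

definition vac_words :: "'c set" where "vac_words = {wedge vec xs * vac | xs. True}"

lemma span_vac_words_mult:
  assumes "v \<in> C.span vac_words" "\<And>xs. c * (wedge vec xs * vac) \<in> C.span vac_words"
  shows "c * v \<in> C.span vac_words"
proof -
  have "C.subspace {v. c * v \<in> C.span vac_words}"
    by (rule C.subspaceI)
      (auto simp: distrib_left C.scale_mult_right intro: C.span_zero C.span_add C.span_scale)
  moreover have "c * v \<in> C.span vac_words" if "v \<in> vac_words" for v
    using that assms(2) by (auto simp: vac_words_def)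
  ultimately show ?thesis
    using C.span_induct[OF assms(1), of "\<lambda>v. c * v \<in> C.span vac_words"] by simp
qed

lemma wedge_vac_in_span: "wedge vec xs * vac \<in> C.span vac_words"
  by (rule C.span_base) (auto simp: vac_words_def)

lemma span_vac_words_vec: "v \<in> C.span vac_words \<Longrightarrow> vec x * v \<in> C.span vac_words"
proof (erule span_vac_words_mult)
  show "vec x * (wedge vec xs * vac) \<in> C.span vac_words" for xs
    using wedge_vac_in_span[of "x # xs"] by (simp add: mult.assoc)
qed

lemma span_vac_words_cov:
  assumes \<xi>: "\<xi> \<in> dual_space sg" and v: "v \<in> C.span vac_words"
  shows "cov \<xi> * v \<in> C.span vac_words"
  using v
proof (rule span_vac_words_mult)
  show "cov \<xi> * (wedge vec xs * vac) \<in> C.span vac_words" for xs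
  proof (induction xs)
    case Nil
    show ?case by (simp add: cov_vac \<xi> C.span_zero)
  next
    case (Cons x xs)
    have "cov \<xi> * (wedge vec (x # xs) * vac) = (cov \<xi> * vec x) * (wedge vec xs * vac)"
      by (simp add: mult.assoc)
    also have "\<dots> = sC (\<xi> x) (wedge vec xs * vac) - vec x * (cov \<xi> * (wedge vec xs * vac))"
      by (simp add: \<xi> cov_vec left_diff_distrib C.scale_mult_left mult.assoc)
    finally show ?case
      using span_vac_words_vec[OF Cons] by (auto intro!: C.span_diff C.span_scale wedge_vac_in_span)
  qed
qed

lemma left_ideal_vac: "c * vac \<in> C.span vac_words"
proof (induction c rule: clifford_induct)
  case one
  show ?case using wedge_vac_in_span[of "[]"] by simp
qed (auto simp: span_vac_words_vec span_vac_words_cov mult.assoc distrib_right C.scale_mult_left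
    intro: C.span_add C.span_scale)

lemma vac_sandwich: "\<exists>k. vac * c * vac = sC k vac"
proof -
  have "C.subspace {v. \<exists>k. vac * v = sC k vac}"
  proof (rule C.subspaceI)
    show "0 \<in> {v. \<exists>k. vac * v = sC k vac}"
      by (auto intro: exI[of _ 0])
    show "v + w \<in> {v. \<exists>k. vac * v = sC k vac}"
      if "v \<in> {v. \<exists>k. vac * v = sC k vac}" "w \<in> {v. \<exists>k. vac * v = sC k vac}" for v w
      using that by (auto simp: distrib_left simp flip: C.scale_left_distrib)
    show "sC k v \<in> {v. \<exists>k. vac * v = sC k vac}"
      if "v \<in> {v. \<exists>k. vac * v = sC k vac}" for k v
      using that by (auto simp: C.scale_mult_right)
  qed
  moreover have "\<exists>k. vac * v = sC k vac" if mem: "v \<in> vac_words" for v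
  proof -
    obtain xs where v: "v = wedge vec xs * vac"
      using mem by (auto simp: vac_words_def)
    show ?thesis
    proof (cases xs)
      case Nil
      then show ?thesis by (auto simp: v vac_idem intro: exI[of _ 1])
    next
      case (Cons x ys)
      then have "vac * v = (vac * vec x) * (wedge vec ys * vac)"
        by (simp add: v mult.assoc)
      then show ?thesis by (auto simp: vac_vec intro: exI[of _ 0])
    qed
  qed
  ultimately have "\<exists>k. vac * (c * vac) = sC k vac"
    using C.span_induct[OF left_ideal_vac, of "\<lambda>v. \<exists>k. vac * v = sC k vac"] by blast
  then show ?thesis by (simp add: mult.assoc)
qed

text \<open>The vacuum expectations in \<open>matrix_expansion\<close> are scalar multiples of \<open>vac\<close>.\<close>

lemma matrix_units_span:
  "\<exists>m. c = (\<Sum>I\<in>Pow {..<N}. \<Sum>J\<in>Pow {..<N}. sC (m I J) (matrix_unit I J))"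
proof -
  have "\<forall>I J. \<exists>k. vac * (annihil (entries N I) * c * creat (entries N J)) * vac = sC k vac"
    using vac_sandwich by blast
  then obtain m where
    m: "vac * (annihil (entries N I) * c * creat (entries N J)) * vac = sC (m I J) vac" for I J
    by metis
  show ?thesis
    by (rule exI[of _ m], subst matrix_expansion, simp only: m)
      (simp add: matrix_unit_def C.scale_mult_left C.scale_mult_right)
qed

definition monom :: "nat set \<Rightarrow> 'l" where "monom I = wedge iL (map e (entries N I))"

definition coord :: "nat set \<Rightarrow> 'l \<Rightarrow> 'k" where "coord I l = eps (act (annihil (entries N I)) l)"

lemma act_creat: "act (creat w) l = wedge iL (map e w) * l"
  by (induction w) (simp_all add: act_simps act_vec mult.assoc)

lemma monom_eq_act: "monom I = act (creat (entries N I) * vac) 1"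
  by (simp add: monom_def act_simps act_vac_one act_creat)

lemma act_unit_monom:
  "J \<subseteq> {..<N} \<Longrightarrow> K \<subseteq> {..<N} \<Longrightarrow> act (matrix_unit I J) (monom K) = (if J = K then monom I else 0)"
  by (simp add: monom_eq_act unit_creat_vac act_zero_left flip: act_simps(3))

lemma coord_add: "coord I (l + l') = coord I l + coord I l'"
  and coord_scale: "coord I (sL c l) = c * coord I l"
  by (simp_all add: coord_def act_simps eps_add eps_scale)

lemma coord_monom:
  assumes "I \<subseteq> {..<N}" "K \<subseteq> {..<N}"
  shows "coord I (monom K) = (if I = K then 1 else 0)"
proof -
  have "sL (coord I (monom K)) 1 =
      act (vac * annihil (entries N I) * creat (entries N K) * vac) 1"
    by (simp add: coord_def monom_eq_act act_simps flip: act_vac)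
  also have "\<dots> = (if I = K then 1 else 0)"
    by (simp add: vac_annihil_creat_entries_vac[OF assms] act_vac_one act_zero_left)
  finally have "eps (sL (coord I (monom K)) 1) = eps (if I = K then 1 else 0)"
    by simp
  then show ?thesis by (simp add: eps_scale eps_one split: if_splits)
qed

text \<open>The resolution of the identity applied to \<open>l\<close>: the vacuum turns \<open>annihil (entries N I)\<close> into
  the coordinate, and \<open>creat (entries N I)\<close> restores the monomial.\<close>

lemma monom_expansion: "l = (\<Sum>I\<in>Pow {..<N}. sL (coord I l) (monom I))"
proof -
  have "l = act (\<Sum>I\<in>Pow {..<N}. matrix_unit I I) l"
    by (simp add: resolution_of_identity act_simps)
  also have "\<dots> = (\<Sum>I\<in>Pow {..<N}. sL (coord I l) (monom I))"
    by (simp add: act_sum_left matrix_unit_def act_simps act_vac act_creat monom_def coord_def)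
  finally show ?thesis .
qed

lemma wedge_induct [case_names wedge add scale]:
  assumes "\<And>xs. P (wedge iL xs)" "\<And>l l'. P l \<Longrightarrow> P l' \<Longrightarrow> P (l + l')" "\<And>k l. P l \<Longrightarrow> P (sL k l)"
  shows "P l"
proof -
  have "P 0" using assms(3)[OF assms(1), of 0] by simp
  then have "P (\<Sum>I\<in>S. sL (coord I l) (monom I))" for S
    by (induction S rule: infinite_finite_induct) (simp_all add: assms monom_def)
  then show ?thesis by (subst monom_expansion)
qed


section \<open>Gradings\<close>

abbreviation L_deg :: "int \<Rightarrow> 'l set" where "L_deg \<equiv> exterior_power sL iL"
abbreviation C_deg :: "int \<Rightarrow> 'c set" where "C_deg \<equiv> clifford_component sg sC iC"

lemma L_deg_wedge: "wedge iL xs \<in> L_deg (int (length xs))"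
  unfolding exterior_power_def by (rule L.span_base) auto

lemma L_deg_closed:
  "0 \<in> L_deg p" "l \<in> L_deg p \<Longrightarrow> l' \<in> L_deg p \<Longrightarrow> l + l' \<in> L_deg p"
  "l \<in> L_deg p \<Longrightarrow> l' \<in> L_deg p \<Longrightarrow> l - l' \<in> L_deg p" "l \<in> L_deg p \<Longrightarrow> sL c l \<in> L_deg p"
  unfolding exterior_power_def
  by (auto intro: L.span_zero L.span_add L.span_diff L.span_scale)

lemma L_deg_induct [consumes 1, case_names wedge zero add scale]:
  assumes "l \<in> L_deg p" "\<And>xs. int (length xs) = p \<Longrightarrow> P (wedge iL xs)" "P 0"
    "\<And>l l'. P l \<Longrightarrow> P l' \<Longrightarrow> P (l + l')" "\<And>c l. P l \<Longrightarrow> P (sL c l)"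
  shows "P l"
proof -
  have "L.subspace {l. P l}"
    by (rule L.subspaceI) (use assms in auto)
  then show ?thesis
    using L.span_induct[of l _ P] assms(1,2) unfolding exterior_power_def by auto
qed

lemma L_deg_mult: "l \<in> L_deg p \<Longrightarrow> iL x * l \<in> L_deg (p + 1)"
proof (induction l rule: L_deg_induct)
  case (wedge xs)
  then show ?case using L_deg_wedge[of "x # xs"] by (simp add: add.commute)
qed (simp_all add: distrib_left L.scale_mult_right L_deg_closed)

lemma L_deg_contr:
  assumes "\<xi> \<in> dual_space sg"
  shows "l \<in> L_deg p \<Longrightarrow> contr \<xi> l \<in> L_deg (p - 1)"
proof (induction l rule: L_deg_induct)
  case (wedge xs)
  have "contr \<xi> (wedge iL xs) \<in> L_deg (int (length xs) - 1)" for xs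
  proof (induction xs)
    case (Cons x xs)
    then show ?case
      using L_deg_wedge[of xs] L_deg_mult[OF Cons, of x]
      by (simp add: contr_mult assms L_deg_closed)
  qed (simp add: L_deg_closed)
  then show ?case using wedge by blast
qed (simp_all add: contr_add contr_scale L_deg_closed)

lemma eps_L_deg: "l \<in> L_deg p \<Longrightarrow> p \<noteq> 0 \<Longrightarrow> eps l = 0"
proof (induction l rule: L_deg_induct)
  case (wedge xs)
  then show ?case by (intro eps_wedge) auto
qed (simp_all add: eps_add eps_scale)

lemma C_deg_closed:
  "0 \<in> C_deg n" "c \<in> C_deg n \<Longrightarrow> c' \<in> C_deg n \<Longrightarrow> c + c' \<in> C_deg n" "c \<in> C_deg n \<Longrightarrow> sC k c \<in> C_deg n"
  unfolding clifford_component_def by (auto intro: C.span_zero C.span_add C.span_scale)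

lemma C_deg_induct [consumes 1, case_names word zero add scale]:
  assumes "c \<in> C_deg n"
    "\<And>ws. set ws \<subseteq> clifford_gens sg \<Longrightarrow> sum_list (map clifford_deg ws) = n \<Longrightarrow> P (prod_list (map iC ws))"
    "P 0" "\<And>c c'. P c \<Longrightarrow> P c' \<Longrightarrow> P (c + c')" "\<And>k c. P c \<Longrightarrow> P (sC k c)"
  shows "P c"
proof -
  have "C.subspace {c. P c}"
    by (rule C.subspaceI) (use assms in auto)
  then show ?thesis
    using C.span_induct[of c _ P] assms(1,2) unfolding clifford_component_def by auto
qed

lemma C_deg_word: "set ws \<subseteq> clifford_gens sg \<Longrightarrow> prod_list (map iC ws) \<in> C_deg (sum_list (map clifford_deg ws))"
  unfolding clifford_component_def by (rule C.span_base) auto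

lemma C_deg_mult:
  assumes c: "c \<in> C_deg m" and c': "c' \<in> C_deg n"
  shows "c * c' \<in> C_deg (m + n)"
  using c
proof (induction c rule: C_deg_induct)
  case (word ws)
  show ?case using c'
  proof (induction c' rule: C_deg_induct)
    case (word vs)
    then show ?case using C_deg_word[of "ws @ vs"] \<open>set ws \<subseteq> _\<close> \<open>_ = m\<close> by simp
  qed (simp_all add: distrib_left C.scale_mult_right C_deg_closed)
qed (simp_all add: distrib_right C.scale_mult_left C_deg_closed)

lemma C_deg_one: "1 \<in> C_deg 0" and C_deg_vec: "vec x \<in> C_deg (- 1)"
  and C_deg_cov: "\<xi> \<in> dual_space sg \<Longrightarrow> cov \<xi> \<in> C_deg 1"
  using C_deg_word[of "[]"] C_deg_word[of "[Inl x]"] C_deg_word[of "[Inr \<xi>]"] by simp_all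

lemma C_deg_act:
  assumes "c \<in> C_deg n" "l \<in> L_deg p"
  shows "act c l \<in> L_deg (p - n)"
  using assms(1)
proof (induction c rule: C_deg_induct)
  case (word ws)
  have "set ws \<subseteq> clifford_gens sg \<Longrightarrow>
      act (prod_list (map iC ws)) l \<in> L_deg (p - sum_list (map clifford_deg ws))" for ws
  proof (induction ws)
    case Nil
    then show ?case using assms(2) by (simp add: act_simps)
  next
    case (Cons w ws)
    then have IH: "act (prod_list (map iC ws)) l \<in> L_deg (p - sum_list (map clifford_deg ws))"
      by simp
    show ?case
    proof (cases w)
      case (Inl x)
      then show ?thesis using L_deg_mult[OF IH, of x]
        by (simp add: act_simps act_vec algebra_simps)
    next
      case (Inr \<xi>)
      then show ?thesis using L_deg_contr[OF _ IH, of \<xi>] Cons.prems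
        by (simp add: act_simps act_cov algebra_simps)
    qed
  qed
  with word show ?case by blast
qed (simp_all add: act_zero_left act_simps L_deg_closed)

lemma C_deg_creat: "creat w \<in> C_deg (- int (length w))"
proof (induction w)
  case (Cons i w)
  then show ?case using C_deg_mult[OF C_deg_vec Cons, of "e i"] by simp
qed (simp add: C_deg_one)

lemma C_deg_annihil: "annihil w \<in> C_deg (int (length w))"
proof (induction w)
  case (Cons i w)
  then show ?case
    using C_deg_mult[OF Cons C_deg_cov[OF dual_in_dual_space], of i] by (simp add: add.commute)
qed (simp add: C_deg_one)

lemma C_deg_vac: "vac \<in> C_deg 0"
proof -
  have "vac_below m \<in> C_deg 0" for m
  proof (induction m)
    case (Suc m)
    from C_deg_mult[OF this C_deg_mult[OF C_deg_cov[OF dual_in_dual_space] C_deg_vec]]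
    show ?case by simp
  qed (simp add: C_deg_one)
  then show ?thesis by (simp add: vac_def)
qed

lemma C_deg_unit:
  assumes "I \<subseteq> {..<N}" "J \<subseteq> {..<N}"
  shows "matrix_unit I J \<in> C_deg (int (card J) - int (card I))"
  using C_deg_mult[OF C_deg_mult[OF C_deg_creat C_deg_vac] C_deg_annihil, of "entries N I" "entries N J"]
  by (simp add: matrix_unit_def length_entries assms)

lemma monom_deg: "I \<subseteq> {..<N} \<Longrightarrow> monom I \<in> L_deg (int (card I))"
  using L_deg_wedge[of "map e (entries N I)"] by (simp add: monom_def length_entries)

lemma coord_L_deg:
  assumes "l \<in> L_deg p" "I \<subseteq> {..<N}" "p \<noteq> int (card I)"
  shows "coord I l = 0"
  unfolding coord_def
  by (rule eps_L_deg[OF C_deg_act[OF C_deg_annihil assms(1)]])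
    (use assms in \<open>simp add: length_entries\<close>)

end


section \<open>The complex as a tensor product of the coefficient and exterior algebras\<close>

lemma balanced_mapD:
  assumes "balanced_map ra la h"
  shows "h (m + m') n = h m n + h m' n" "h m (n + n') = h m n + h m n'" "h (ra m r) n = h m (la r n)"
  using assms unfolding balanced_map_def by blast+

lemma group_closure_trans:
  assumes "\<And>s. s \<in> S \<Longrightarrow> s \<in> group_closure T" "x \<in> group_closure S"
  shows "x \<in> group_closure T"
  by (rule additive_image_group_closure[of "\<lambda>x. x", OF _ assms]) (simp add: additive_def)

locale brst = clifford sg br N e sL iL sC iC
  for sg :: "'k::field \<Rightarrow> 'g::ab_group_add \<Rightarrow> 'g" and br :: "'g \<Rightarrow> 'g \<Rightarrow> 'g"
    and N :: nat and e :: "nat \<Rightarrow> 'g"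
    and sL :: "'k \<Rightarrow> 'l::ring_1 \<Rightarrow> 'l" and iL :: "'g \<Rightarrow> 'l"
    and sC :: "'k \<Rightarrow> 'c::ring_1 \<Rightarrow> 'c" and iC :: "'g + ('g \<Rightarrow> 'k) \<Rightarrow> 'c" +
  fixes sU :: "'k \<Rightarrow> 'u::ring_1 \<Rightarrow> 'u" and iU :: "'g \<Rightarrow> 'u"
    and sA :: "'k \<Rightarrow> 'a::ring_1 \<Rightarrow> 'a" and incl :: "'u \<Rightarrow> 'a"
    and tX :: "'u \<Rightarrow> 'l \<Rightarrow> 'x::ab_group_add"
    and tZ :: "'a \<Rightarrow> 'x \<Rightarrow> 'z::ab_group_add"
    and tB :: "'a \<Rightarrow> 'c \<Rightarrow> 'b::ring_1"
  assumes U: "enveloping_algebra sg br sU iU"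
    and A: "assoc_algebra sA"
    and incl: "algebra_hom sU sA incl"
    and X: "tensor_product (\<lambda>u k. sU k u) sL tX"
    and Z: "tensor_product (\<lambda>a u. a * incl u) (left_mult_action tX) tZ"
    and B: "opp_tensor_algebra sA sC tB"
begin

lemma presented_U:
  "presented_algebra sU UNIV (linearity_rels sg id \<union>
     {fgen x * fgen y - fgen y * fgen x - fgen (br x y) | x y. True}) iU"
  using U by (simp add: enveloping_algebra_def)

sublocale U: assoc_algebra sU
  using presented_U by (simp add: presented_algebra_def)

sublocale A: assoc_algebra sA
  by (rule A)

lemma incl_add: "incl (u + v) = incl u + incl v"
  and incl_mult: "incl (u * v) = incl u * incl v"
  and incl_one: "incl 1 = 1"
  and incl_scale: "incl (sU k u) = sA k (incl u)"
  using incl by (simp_all add: algebra_hom_def)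

lemma additive_incl: "additive incl"
  by (simp add: additive_def incl_add)

lemma
  shows iU_add: "iU (x + y) = iU x + iU y"
    and iU_scale: "iU (sg c x) = sU c (iU x)"
    and iU_br: "iU (br x y) = iU x * iU y - iU y * iU x"
proof -
  let ?R = "linearity_rels sg id \<union>
     {fgen x * fgen y - fgen y * fgen x - fgen (br x y) | x y. True} :: ('g, 'k) free_alg set"
  obtain F where F: "free_algebra_map sU UNIV iU F" "\<And>r. r \<in> ?R \<Longrightarrow> F r = 0"
    using presented_algebra_relations[OF presented_U] by blast
  note F_simps = free_algebra_map_simps[OF F(1)]
  have "F (fgen (id (x + y)) - fgen (id x) - fgen (id y)) = 0"
    by (rule F(2)) (unfold linearity_rels_def, blast)
  then show "iU (x + y) = iU x + iU y" by (simp add: F_simps diff_diff_eq)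
  have "F (fgen (id (sg c x)) - fconst c * fgen (id x)) = 0"
    by (rule F(2)) (unfold linearity_rels_def, blast)
  then show "iU (sg c x) = sU c (iU x)" by (simp add: F_simps U.scale_mult_left)
  have "F (fgen x * fgen y - fgen y * fgen x - fgen (br x y)) = 0"
    by (rule F(2)) blast
  then show "iU (br x y) = iU x * iU y - iU y * iU x" by (simp add: F_simps)
qed

lemma iU_zero: "iU 0 = 0"
  using iU_add[of 0 0] by simp

lemma iU_sum: "iU (sum f I) = (\<Sum>i\<in>I. iU (f i))"
  by (induction I rule: infinite_finite_induct) (simp_all add: iU_add iU_zero)

lemma iU_expansion: "iU x = (\<Sum>i<N. sU (dual i x) (iU (e i)))"
  by (subst basis_expansion[of x]) (simp add: iU_sum iU_scale)

definition iA :: "'g \<Rightarrow> 'a" where "iA x = incl (iU x)"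

lemma iA_br: "iA (br x y) = iA x * iA y - iA y * iA x"
  by (simp add: iA_def iU_br incl_mult additive.diff[OF additive_incl])

lemma iA_expansion: "iA x = (\<Sum>i<N. sA (dual i x) (iA (e i)))"
  unfolding iA_def by (subst iU_expansion) (simp add: additive.sum[OF additive_incl] incl_scale)

lemmas tX_simps = balanced_mapD[OF tensor_product_balanced[OF X]]
lemmas tZ_simps = balanced_mapD[OF tensor_product_balanced[OF Z]]

lemma additive_tX: "additive (\<lambda>u. tX u l)" "additive (\<lambda>l. tX u l)"
  by (simp_all add: additive_def tX_simps)

lemma additive_tZ: "additive (\<lambda>a. tZ a x)" "additive (\<lambda>x. tZ a x)"
  by (simp_all add: additive_def tZ_simps)

lemma
  shows additive_X_act: "additive (left_mult_action tX u)"
    and X_act: "left_mult_action tX u (tX v l) = tX (u * v) l"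
proof -
  have "balanced_map (\<lambda>u k. sU k u) sL (\<lambda>v l. tX (u * v) l)"
    by (rule balanced_mapI) (simp_all add: tX_simps distrib_left U.scale_mult_right)
  from additive_tensor_lift[OF X this] tensor_lift_apply[OF X this]
  show "additive (left_mult_action tX u)" "left_mult_action tX u (tX v l) = tX (u * v) l"
    by (simp_all add: left_mult_action_def)
qed

text \<open>The pure tensor of \<open>a\<close> and \<open>l\<close> under the identification of \<open>A \<otimes>\<^sub>U (U \<otimes> \<Lambda>)\<close> with \<open>A \<otimes> \<Lambda>\<close>.\<close>

definition s :: "'a \<Rightarrow> 'l \<Rightarrow> 'z" where "s a l = tZ a (tX 1 l)"

lemma tZ_tX: "tZ a (tX u l) = s (a * incl u) l"
  by (simp add: s_def tZ_simps X_act)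

lemma s_add_left: "s (a + a') l = s a l + s a' l"
  and s_add_right: "s a (l + l') = s a l + s a l'"
  by (simp_all add: s_def tZ_simps tX_simps)

lemma s_scale: "s (sA k a) l = s a (sL k l)"
proof -
  have "sA k a = a * incl (sU k 1)"
    by (simp add: incl_scale incl_one A.scale_mult_right)
  then have "s (sA k a) l = tZ a (tX (sU k 1) l)" by (simp add: tZ_tX)
  then show ?thesis by (simp only: tX_simps(3) s_def)
qed

lemma additive_s: "additive (\<lambda>a. s a l)" "additive (\<lambda>l. s a l)"
  by (simp_all add: additive_def s_add_left s_add_right)

lemmas s_zero [simp] = additive.zero[OF additive_s(1)] additive.zero[OF additive_s(2)]
lemmas s_diff_left = additive.diff[OF additive_s(1)] and s_diff_right = additive.diff[OF additive_s(2)]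
  and s_minus_right = additive.minus[OF additive_s(2)]
  and s_sum_left = additive.sum[OF additive_s(1)] and s_sum_right = additive.sum[OF additive_s(2)]

lemma s_generated: "z \<in> group_closure {s a l | a l. True}"
proof (rule group_closure_trans[OF _ tensor_product_generated[OF Z]])
  fix z assume "z \<in> {tZ a x | a x. True}"
  then obtain a x where z: "z = tZ a x" by blast
  show "z \<in> group_closure {s a l | a l. True}"
    unfolding z
  proof (rule additive_image_group_closure[OF additive_tZ(2) _ tensor_product_generated[OF X]])
    fix y assume "y \<in> {tX u l | u l. True}"
    then obtain u l where "y = tX u l" by blast
    then have "tZ a y = s (a * incl u) l" by (simp add: tZ_tX)
    then show "tZ a y \<in> group_closure {s a l | a l. True}"
      by (intro group_closure_base CollectI exI conjI TrueI)
  qed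
qed

lemma s_ext:
  assumes "additive f" "additive g" "\<And>a l. f (s a l) = g (s a l)"
  shows "f z = g z"
  by (rule additive_eq_on_group_closure[OF assms(1,2) _ s_generated]) (use assms(3) in auto)

text \<open>The universal property of \<open>A \<otimes> \<Lambda>\<close>, obtained by lifting first over the inner and then over the
  outer tensor product.  The inner lift is compatible with the action of \<open>U\<close> because
  \<open>a \<otimes> u\<close> only enters through \<open>a * incl u\<close>.\<close>

definition s_lift :: "('a \<Rightarrow> 'l \<Rightarrow> 'h::ab_group_add) \<Rightarrow> 'z \<Rightarrow> 'h" where
  "s_lift h = tensor_lift tZ (\<lambda>a. tensor_lift tX (\<lambda>u l. h (a * incl u) l))"

lemma
  assumes h: "balanced_map (\<lambda>a k. sA k a) sL h"
  shows additive_s_lift: "additive (s_lift h)"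
    and s_lift_apply: "s_lift h (s a l) = h a l"
proof -
  note h_simps = balanced_mapD[OF h]
  have X_balanced: "balanced_map (\<lambda>u k. sU k u) sL (\<lambda>u l. h (a * incl u) l)" for a
    by (rule balanced_mapI)
      (simp_all add: h_simps incl_add distrib_left incl_scale A.scale_mult_right)
  let ?hX = "\<lambda>a. tensor_lift tX (\<lambda>u l. h (a * incl u) l)"
  note add = additive_tensor_lift[OF X X_balanced] and lift_on_tensors = tensor_lift_apply[OF X X_balanced]
  have Z_balanced: "balanced_map (\<lambda>a u. a * incl u) (left_mult_action tX) ?hX"
  proof (rule balanced_mapI)
    fix a a' x u
    show "?hX (a + a') x = ?hX a x + ?hX a' x"
      by (rule tensor_product_ext[OF X add additive_add[OF add add]])
        (unfold lift_on_tensors, simp add: distrib_right h_simps)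
    show "?hX (a * incl u) x = ?hX a (left_mult_action tX u x)"
      by (rule tensor_product_ext[OF X add additive_compose[OF add additive_X_act]])
        (unfold X_act lift_on_tensors, simp add: incl_mult mult.assoc)
  qed (rule additive.add[OF add])
  show "additive (s_lift h)"
    unfolding s_lift_def by (rule additive_tensor_lift[OF Z Z_balanced])
  show "s_lift h (s a l) = h a l"
    unfolding s_lift_def s_def by (simp add: tensor_lift_apply[OF Z Z_balanced] lift_on_tensors incl_one)
qed

abbreviation Z_act :: "'a \<Rightarrow> 'z \<Rightarrow> 'z" where "Z_act \<equiv> left_mult_action tZ"
abbreviation Z_scale :: "'k \<Rightarrow> 'z \<Rightarrow> 'z" where "Z_scale \<equiv> left_scale sA tZ"

lemma
  shows additive_Z_act: "additive (Z_act a)" and Z_act: "Z_act a (s a' l) = s (a * a') l"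
proof -
  have "balanced_map (\<lambda>a u. a * incl u) (left_mult_action tX) (\<lambda>a' x. tZ (a * a') x)"
    by (rule balanced_mapI) (simp_all add: tZ_simps distrib_left flip: mult.assoc)
  from additive_tensor_lift[OF Z this] tensor_lift_apply[OF Z this]
  show "additive (Z_act a)" "Z_act a (s a' l) = s (a * a') l"
    by (simp_all add: left_mult_action_def s_def)
qed

lemma
  shows additive_Z_scale: "additive (Z_scale k)" and Z_scale: "Z_scale k (s a l) = s (sA k a) l"
proof -
  have "balanced_map (\<lambda>a u. a * incl u) (left_mult_action tX) (\<lambda>a x. tZ (sA k a) x)"
    by (rule balanced_mapI)
      (simp_all add: tZ_simps A.scale_right_distrib flip: A.scale_mult_left)
  from additive_tensor_lift[OF Z this] tensor_lift_apply[OF Z this]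
  show "additive (Z_scale k)" "Z_scale k (s a l) = s (sA k a) l"
    by (simp_all add: left_scale_def s_def)
qed


section \<open>The action of the BRST algebra on the complex\<close>

lemma tB_tensor: "tensor_product (\<lambda>a k. sA k a) sC tB"
  and tB_mult: "tB a c * tB a' c' = tB (a' * a) (c * c')"
  and tB_one: "tB 1 1 = 1"
  using B by (simp_all add: opp_tensor_algebra_def)

lemmas tB_simps = balanced_mapD[OF tensor_product_balanced[OF tB_tensor]]

lemma additive_tB: "additive (\<lambda>a. tB a c)" "additive (\<lambda>c. tB a c)"
  by (simp_all add: additive_def tB_simps)

abbreviation B_scale :: "'k \<Rightarrow> 'b \<Rightarrow> 'b" where "B_scale \<equiv> left_scale sA tB"

lemma
  shows additive_B_scale: "additive (B_scale k)" and B_scale: "B_scale k (tB a c) = tB (sA k a) c"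
proof -
  have "balanced_map (\<lambda>a k. sA k a) sC (\<lambda>a c. tB (sA k a) c)"
    by (rule balanced_mapI)
      (simp_all add: tB_simps A.scale_right_distrib C.scale_left_commute)
  from additive_tensor_lift[OF tB_tensor this] tensor_lift_apply[OF tB_tensor this]
  show "additive (B_scale k)" "B_scale k (tB a c) = tB (sA k a) c"
    by (simp_all add: left_scale_def)
qed

text \<open>Right multiplication by \<open>a'\<close> on \<open>A\<close> does not descend to \<open>A \<otimes>\<^sub>U X\<close> factor by factor, but it does
  after the identification with \<open>A \<otimes> \<Lambda>\<close>.\<close>

definition pure_op :: "'a \<Rightarrow> 'c \<Rightarrow> 'z \<Rightarrow> 'z" where
  "pure_op a' c = s_lift (\<lambda>a l. s (a * a') (act c l))"

lemma
  shows additive_pure_op: "additive (pure_op a' c)"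
    and pure_op: "pure_op a' c (s a l) = s (a * a') (act c l)"
proof -
  have "balanced_map (\<lambda>a k. sA k a) sL (\<lambda>a l. s (a * a') (act c l))"
    by (rule balanced_mapI)
      (simp_all add: act_simps s_add_left s_add_right distrib_right A.scale_mult_left s_scale)
  from additive_s_lift[OF this] s_lift_apply[OF this]
  show "additive (pure_op a' c)" "pure_op a' c (s a l) = s (a * a') (act c l)"
    by (simp_all add: pure_op_def)
qed

definition rho :: "'b \<Rightarrow> 'z \<Rightarrow> 'z" where
  "rho b z = tensor_lift tB (\<lambda>a' c. pure_op a' c z) b"

lemma
  shows additive_rho_left: "additive (\<lambda>b. rho b z)"
    and rho_pure: "rho (tB a' c) z = pure_op a' c z"
proof -
  have "balanced_map (\<lambda>a k. sA k a) sC (\<lambda>a' c. pure_op a' c z)"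
  proof (rule balanced_mapI)
    fix a a' c c' k
    show "pure_op (a + a') c z = pure_op a c z + pure_op a' c z"
      by (rule s_ext[OF additive_pure_op additive_add[OF additive_pure_op additive_pure_op]])
        (simp add: pure_op distrib_left s_add_left)
    show "pure_op a (c + c') z = pure_op a c z + pure_op a c' z"
      by (rule s_ext[OF additive_pure_op additive_add[OF additive_pure_op additive_pure_op]])
        (simp add: pure_op act_simps s_add_right)
    show "pure_op (sA k a) c z = pure_op a (sC k c) z"
      by (rule s_ext[OF additive_pure_op additive_pure_op])
        (simp add: pure_op act_simps A.scale_mult_right s_scale)
  qed
  from additive_tensor_lift[OF tB_tensor this] tensor_lift_apply[OF tB_tensor this]
  show "additive (\<lambda>b. rho b z)" "rho (tB a' c) z = pure_op a' c z"
    by (simp_all add: rho_def)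
qed

lemma rho_s: "rho (tB a' c) (s a l) = s (a * a') (act c l)"
  by (simp add: rho_pure pure_op)

lemma additive_rho: "additive (rho b)"
proof (rule additive.intro)
  fix z z'
  show "rho b (z + z') = rho b z + rho b z'"
    by (rule tensor_product_ext[OF tB_tensor additive_rho_left
          additive_add[OF additive_rho_left additive_rho_left]])
      (simp add: rho_pure additive.add[OF additive_pure_op])
qed

lemmas rho_add_left = additive.add[OF additive_rho_left]
  and rho_diff_left = additive.diff[OF additive_rho_left]
  and rho_zero_left = additive.zero[OF additive_rho_left]
  and rho_minus_left = additive.minus[OF additive_rho_left]
  and rho_sum_left = additive.sum[OF additive_rho_left]
  and rho_add = additive.add[OF additive_rho]
  and rho_diff = additive.diff[OF additive_rho]
  and rho_zero = additive.zero[OF additive_rho]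

text \<open>Right multiplications compose in the opposite order, which is why the coefficients enter the
  BRST algebra through \<open>A\<^sup>o\<^sup>p\<^sup>p\<close>.\<close>

lemma rho_mult: "rho (b * b') z = rho b (rho b' z)"
proof (rule tensor_product_ext[OF tB_tensor, where f = "\<lambda>b. rho (b * b') z"
      and g = "\<lambda>b. rho b (rho b' z)"])
  show "additive (\<lambda>b. rho (b * b') z)"
    by (rule additive_compose[OF additive_rho_left]) (simp add: additive_def distrib_right)
  show "additive (\<lambda>b. rho b (rho b' z))" by (rule additive_rho_left)
  fix a c
  show "rho (tB a c * b') z = rho (tB a c) (rho b' z)"
  proof (rule tensor_product_ext[OF tB_tensor, where f = "\<lambda>b'. rho (tB a c * b') z"
        and g = "\<lambda>b'. rho (tB a c) (rho b' z)"])
    show "additive (\<lambda>b'. rho (tB a c * b') z)"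
      by (rule additive_compose[OF additive_rho_left]) (simp add: additive_def distrib_left)
    show "additive (\<lambda>b'. rho (tB a c) (rho b' z))"
      by (rule additive_compose[OF additive_rho additive_rho_left])
    fix a' c'
    show "rho (tB a c * tB a' c') z = rho (tB a c) (rho (tB a' c') z)"
      by (rule s_ext[OF additive_rho additive_compose[OF additive_rho additive_rho]])
        (simp add: tB_mult rho_s act_simps mult.assoc)
  qed
qed

lemma rho_one: "rho 1 z = z"
  by (rule s_ext[OF additive_rho])
    (simp_all add: additive_def rho_s act_simps flip: tB_one)

lemma rho_Z_act: "rho b (Z_act a z) = Z_act a (rho b z)"
proof (rule tensor_product_ext[OF tB_tensor additive_rho_left
      additive_compose[OF additive_Z_act additive_rho_left]])
  fix a' c
  show "rho (tB a' c) (Z_act a z) = Z_act a (rho (tB a' c) z)"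
    by (rule s_ext[OF additive_compose[OF additive_rho additive_Z_act]
          additive_compose[OF additive_Z_act additive_rho]])
      (simp add: rho_s Z_act mult.assoc)
qed

lemma rho_B_scale: "rho (B_scale k b) z = Z_scale k (rho b z)"
proof (rule tensor_product_ext[OF tB_tensor additive_compose[OF additive_rho_left additive_B_scale]
      additive_compose[OF additive_Z_scale additive_rho_left]])
  fix a' c
  show "rho (B_scale k (tB a' c)) z = Z_scale k (rho (tB a' c) z)"
    by (rule s_ext[OF additive_rho additive_compose[OF additive_Z_scale additive_rho]])
      (simp add: rho_s B_scale Z_scale A.scale_mult_right)
qed


section \<open>The differential of the complex is the action of the BRST element\<close>

abbreviation dX :: "'x \<Rightarrow> 'x" where "dX \<equiv> resolution_diff br iU iL tX"
abbreviation dZ :: "'z \<Rightarrow> 'z" where "dZ \<equiv> tensor_lift tZ (\<lambda>a x. tZ a (dX x))"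
abbreviation d :: 'b where "d \<equiv> brst_element sg br N e (\<lambda>x. incl (iU x)) iC tB"

lemma tX_sign: "tX ((- 1) ^ n * u) l = tX u ((- 1) ^ n * l)"
  by (cases "even n")
    (simp_all add: additive.minus[OF additive_tX(1)] additive.minus[OF additive_tX(2)])

text \<open>The coordinate formula in terms of the basis is manifestly well defined on the tensor product, and
  by the formulas for contractions of products it has the values that characterise the
  differential.\<close>

lemma
  shows additive_dX: "additive dX"
    and dX: "dX (tX u l) = (\<Sum>i<N. tX (u * iU (e i)) (contr (dual i) l)) + tX u (bracket_contr l)"
proof -
  let ?h = "\<lambda>u l. (\<Sum>i<N. tX (u * iU (e i)) (contr (dual i) l)) + tX u (bracket_contr l)"
  let ?spec = "\<lambda>D. additive D \<and> (\<forall>u xs. D (tX u (wedge iL xs)) =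
      (\<Sum>i<length xs. tX ((- 1) ^ i * (u * iU (xs ! i))) (wedge iL (nths xs (- {i})))) +
      (\<Sum>j<length xs. \<Sum>i<j. tX ((- 1) ^ (i + j) * u)
         (iL (br (xs ! i) (xs ! j)) * wedge iL (nths xs (- {i, j})))))"
  have h: "balanced_map (\<lambda>u k. sU k u) sL ?h"
    by (rule balanced_mapI)
      (simp_all add: tX_simps contr_add contr_scale additive.add[OF additive_bracket_contr]
        bracket_contr_scale distrib_right sum.distrib U.scale_mult_left algebra_simps)
  define D where "D = tensor_lift tX ?h"
  note D = additive_tensor_lift[OF X h, folded D_def] tensor_lift_apply[OF X h, folded D_def]
  have "?spec D"
  proof (intro conjI allI D(1))
    fix u xs
    let ?w = "\<lambda>k. (- 1) ^ k * wedge iL (nths xs (- {k}))"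
    have "(\<Sum>i<N. tX (u * iU (e i)) (contr (dual i) (wedge iL xs))) =
        (\<Sum>i<N. \<Sum>k<length xs. tX (u * sU (dual i (xs ! k)) (iU (e i))) (?w k))"
      by (simp add: contr_wedge dual_in_dual_space additive.sum[OF additive_tX(2)]
          U.scale_mult_right tX_simps(3))
    also have "\<dots> = (\<Sum>k<length xs. \<Sum>i<N. tX (u * sU (dual i (xs ! k)) (iU (e i))) (?w k))"
      by (rule sum.swap)
    also have "\<dots> = (\<Sum>k<length xs. tX (u * iU (xs ! k)) (?w k))"
      by (subst (2) iU_expansion) (simp add: sum_distrib_left additive.sum[OF additive_tX(1)])
    finally show "D (tX u (wedge iL xs)) =
      (\<Sum>i<length xs. tX ((- 1) ^ i * (u * iU (xs ! i))) (wedge iL (nths xs (- {i})))) +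
      (\<Sum>j<length xs. \<Sum>i<j. tX ((- 1) ^ (i + j) * u)
         (iL (br (xs ! i) (xs ! j)) * wedge iL (nths xs (- {i, j}))))"
      by (simp add: D(2) tX_sign bracket_contr_wedge additive.sum[OF additive_tX(2)])
  qed
  moreover have "D' = D" if "?spec D'" for D'
  proof
    fix x
    show "D' x = D x"
    proof (rule tensor_product_ext[OF X, where f = D' and g = D])
      show "additive D'" using that by blast
      show "additive D" by (rule D(1))
      have "\<forall>u. D' (tX u l) = D (tX u l)" for l
      proof (induction l rule: wedge_induct)
        case (wedge xs)
        show ?case using that \<open>?spec D\<close> by simp
      next
        case (add l l')
        then show ?case
          by (simp add: tX_simps additive.add[OF \<open>additive D'\<close>] additive.add[OF D(1)])
      qed (simp flip: tX_simps(3))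
      then show "D' (tX u l) = D (tX u l)" for u l by blast
    qed
  qed
  ultimately have "dX = D"
    unfolding resolution_diff_def by (rule the_equality)
  then show "additive dX" "dX (tX u l) = ?h u l"
    using D by simp_all
qed

lemma dX_linear: "dX (left_mult_action tX u x) = left_mult_action tX u (dX x)"
  by (rule tensor_product_ext[OF X additive_compose[OF additive_dX additive_X_act]
        additive_compose[OF additive_X_act additive_dX]])
    (simp add: X_act dX additive.add[OF additive_X_act] additive.sum[OF additive_X_act] mult.assoc)

lemma
  shows additive_dZ: "additive dZ"
    and dZ: "dZ (s a l) = (\<Sum>i<N. s (a * iA (e i)) (contr (dual i) l)) + s a (bracket_contr l)"
proof -
  have h: "balanced_map (\<lambda>a u. a * incl u) (left_mult_action tX) (\<lambda>a x. tZ a (dX x))"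
    by (rule balanced_mapI) (simp_all add: tZ_simps dX_linear additive.add[OF additive_dX])
  show "additive dZ" by (rule additive_tensor_lift[OF Z h])
  show "dZ (s a l) = (\<Sum>i<N. s (a * iA (e i)) (contr (dual i) l)) + s a (bracket_contr l)"
    unfolding s_def[of a l] tensor_lift_apply[OF Z h] dX
    by (simp add: tZ_simps additive.sum[OF additive_tZ(2)] tZ_tX iA_def incl_one)
qed

lemma rho_d: "rho d z = dZ z"
  by (rule s_ext[OF additive_rho additive_dZ])
    (simp add: brst_element_def rho_add_left rho_sum_left rho_s dZ act_simps act_vec act_cov
      dual_in_dual_space iA_def bracket_contr_def s_sum_right mult.assoc)

end


section \<open>Differential graded algebras\<close>

text \<open>Every element of the target is an image, and the isomorphism intertwines the differentials.\<close>

lemma is_complex_transfer: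
  assumes iso: "dga_isomorphism D E \<phi>" and D: "is_complex D"
    and zero: "\<And>n. \<phi> n (dg_zero D) = dg_zero E"
  shows "is_complex E"
  unfolding is_complex_def
proof (intro allI ballI)
  fix n y assume "y \<in> dg_carrier E n"
  have onto: "\<phi> n ` dg_carrier D n = dg_carrier E n" for n
    using iso unfolding dga_isomorphism_def bij_betw_def by blast
  obtain x where x: "x \<in> dg_carrier D n" "y = \<phi> n x"
    using \<open>y \<in> dg_carrier E n\<close> unfolding onto[symmetric] by blast
  note Dx = D[unfolded is_complex_def, rule_format, OF x(1)]
  have comm: "\<phi> (n + 1) (dg_diff D n x) = dg_diff E n (\<phi> n x)" if "x \<in> dg_carrier D n" for n x
    using iso that unfolding dga_isomorphism_def by blast
  have "\<phi> (n + 1) (dg_diff D n x) \<in> dg_carrier E (n + 1)"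
    using Dx by (simp flip: onto)
  moreover have "dg_diff E (n + 1) (dg_diff E n y) = dg_zero E"
    using comm[OF x(1)] comm[of "dg_diff D n x" "n + 1"] Dx zero x(2) by simp
  ultimately show "dg_diff E n y \<in> dg_carrier E (n + 1) \<and> dg_diff E (n + 1) (dg_diff E n y) = dg_zero E"
    using comm[OF x(1)] x(2) by simp
qed


section \<open>The BRST element squares to zero\<close>

context brst
begin

text \<open>Both sides are derivations that agree on vectors by the Jacobi identity.\<close>

lemma adjoint_br: "adjoint x (adjoint y l) - adjoint y (adjoint x l) = adjoint (br x y) l"
proof (induction l rule: exterior_induct)
  case (mult z l)
  have "adjoint x (adjoint y (iL z * l)) - adjoint y (adjoint x (iL z * l)) =
      (iL (br x (br y z)) - iL (br y (br x z))) * l +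
      iL z * (adjoint x (adjoint y l) - adjoint y (adjoint x l))"
    by (simp add: adjoint_mult additive.add[OF additive_adjoint] algebra_simps)
  also have "iL (br x (br y z)) - iL (br y (br x z)) = iL (br (br x y) z)"
    using iL_add[of "br (br x y) z" "br y (br x z)"] br_br[of x y z] by (simp add: diff_eq_eq)
  finally show ?case
    by (simp only: mult adjoint_mult)
next
  case (add l l')
  have "adjoint x (adjoint y (l + l')) - adjoint y (adjoint x (l + l')) =
      (adjoint x (adjoint y l) - adjoint y (adjoint x l)) +
      (adjoint x (adjoint y l') - adjoint y (adjoint x l'))"
    by (simp add: additive.add[OF additive_adjoint])
  then show ?case by (simp only: add additive.add[OF additive_adjoint])
next
  case (scale k l)
  then show ?case by (simp add: adjoint_scale flip: L.scale_right_diff_distrib)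
qed (simp add: additive.zero[OF additive_adjoint])

abbreviation ext_mult :: "'g \<Rightarrow> 'z \<Rightarrow> 'z" where "ext_mult y \<equiv> rho (tB 1 (vec y))"

lemma ext_mult_s: "ext_mult y (s a l) = s a (iL y * l)"
  by (simp add: rho_s act_vec)

text \<open>Cartan's formula.  On \<open>A \<otimes> \<Lambda>\<close> this operator is right multiplication by \<open>y\<close> minus the adjoint
  action, from which its commutators are read off.\<close>

definition lie_deriv :: "'g \<Rightarrow> 'z \<Rightarrow> 'z" where
  "lie_deriv y z = dZ (ext_mult y z) + ext_mult y (dZ z)"

lemma additive_lie_deriv: "additive (lie_deriv y)"
  by (simp add: additive_def lie_deriv_def rho_add additive.add[OF additive_dZ] ac_simps)

lemma lie_deriv_s: "lie_deriv y (s a l) = s (a * iA y) l - s a (adjoint y l)"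
proof -
  have "(\<Sum>i<N. s (a * iA (e i)) (sL (dual i y) l)) = s (a * iA y) l"
    by (subst (2) iA_expansion)
      (simp add: sum_distrib_left s_sum_left A.scale_mult_right s_scale)
  then show ?thesis
    by (simp add: lie_deriv_def ext_mult_s dZ rho_add additive.sum[OF additive_rho] contr_mult
        dual_in_dual_space bracket_contr_mult s_diff_right s_minus_right sum_subtractf)
qed

lemma dZ_ext_mult: "dZ (ext_mult y z) = lie_deriv y z - ext_mult y (dZ z)"
  by (simp add: lie_deriv_def)

lemma lie_deriv_ext_mult: "lie_deriv x (ext_mult y z) = ext_mult y (lie_deriv x z) - ext_mult (br x y) z"
proof (rule s_ext[where f = "\<lambda>z. lie_deriv x (ext_mult y z)"
      and g = "\<lambda>z. ext_mult y (lie_deriv x z) - ext_mult (br x y) z"])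
  show "lie_deriv x (ext_mult y (s a l)) = ext_mult y (lie_deriv x (s a l)) - ext_mult (br x y) (s a l)"
    for a l
    by (simp add: ext_mult_s lie_deriv_s rho_diff adjoint_mult s_add_right)
  show "additive (\<lambda>z. lie_deriv x (ext_mult y z))"
    by (rule additive_compose[OF additive_lie_deriv additive_rho])
  show "additive (\<lambda>z. ext_mult y (lie_deriv x z) - ext_mult (br x y) z)"
    by (intro additive_diff additive_compose[OF additive_rho additive_lie_deriv] additive_rho)
qed

lemma lie_deriv_br: "lie_deriv x (lie_deriv y z) - lie_deriv y (lie_deriv x z) = - lie_deriv (br x y) z"
proof (rule s_ext[where f = "\<lambda>z. lie_deriv x (lie_deriv y z) - lie_deriv y (lie_deriv x z)"
      and g = "\<lambda>z. - lie_deriv (br x y) z"])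
  show "lie_deriv x (lie_deriv y (s a l)) - lie_deriv y (lie_deriv x (s a l)) = - lie_deriv (br x y) (s a l)"
    for a l
    by (simp add: lie_deriv_s additive.diff[OF additive_lie_deriv] iA_br right_diff_distrib s_diff_left
        s_diff_right mult.assoc flip: adjoint_br)
  show "additive (\<lambda>z. - lie_deriv (br x y) z)"
    using additive_lie_deriv[of "br x y"] by (simp add: additive_def)
  show "additive (\<lambda>z. lie_deriv x (lie_deriv y z) - lie_deriv y (lie_deriv x z))"
    by (intro additive_diff additive_compose[OF additive_lie_deriv additive_lie_deriv])
qed

lemma dZ_generator: "dZ (s a 1) = 0"
  by (simp add: dZ)

text \<open>The complex is generated, as an abelian group, by the results of applying exterior
  multiplications to the pure tensors \<open>s a 1\<close>; scalars can be moved into the coefficient \<open>a\<close>.\<close>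

lemma ext_mult_induct [case_names generator ext_mult diff]:
  assumes "\<And>a. P (s a 1)" "\<And>y z. P z \<Longrightarrow> P (ext_mult y z)" "\<And>z z'. P z \<Longrightarrow> P z' \<Longrightarrow> P (z - z')"
  shows "P z"
proof -
  have P0: "P 0" using assms(1)[of 0] by simp
  have P_add: "P (z + z')" if "P z" "P z'" for z z'
    using assms(3)[OF that(1) assms(3)[OF P0 that(2)]] by simp
  have P_s: "\<forall>a. P (s a l)" for l
  proof (induction l rule: exterior_induct)
    case one
    show ?case using assms(1) by blast
  next
    case (mult x l)
    show ?case
    proof
      show "P (s a (iL x * l))" for a
        using assms(2)[OF mult[rule_format, of a], of x] by (simp only: ext_mult_s)
    qed
  next
    case (add l l')
    show ?case
    proof
      show "P (s a (l + l'))" for a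
        using P_add[OF add[rule_format]] by (simp only: s_add_right)
    qed
  next
    case (scale k l)
    show ?case
    proof
      show "P (s a (sL k l))" for a
        using scale[rule_format, of "sA k a"] by (simp only: s_scale)
    qed
  qed
  have gen: "{s a l | a l. True} \<subseteq> {z. P z}"
    using P_s by auto
  have "z \<in> {z. P z}"
    by (rule group_closure_least[OF s_generated gen]) (simp_all add: P0 assms(3))
  then show ?thesis by simp
qed

text \<open>The commutator of the two operators anticommutes with exterior multiplications, by
  \<open>lie_deriv_ext_mult\<close> and \<open>lie_deriv_br\<close>, and vanishes on \<open>A \<otimes> 1\<close>.\<close>

lemma dZ_lie_deriv: "dZ (lie_deriv x z) = lie_deriv x (dZ z)"
proof -
  have "\<forall>x. dZ (lie_deriv x z) = lie_deriv x (dZ z)"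
  proof (induction z rule: ext_mult_induct)
    case (generator a)
    show ?case by (simp add: lie_deriv_s dZ_generator additive.zero[OF additive_lie_deriv])
  next
    case (ext_mult y z)
    show ?case
    proof
      fix x
      have "lie_deriv y (lie_deriv x z) - lie_deriv x (lie_deriv y z) = lie_deriv (br x y) z"
        using lie_deriv_br[of x y z] by (simp add: algebra_simps)
      with ext_mult show "dZ (lie_deriv x (ext_mult y z)) = lie_deriv x (dZ (ext_mult y z))"
        by (simp add: lie_deriv_ext_mult dZ_ext_mult additive.diff[OF additive_dZ]
            additive.diff[OF additive_lie_deriv] algebra_simps)
    qed
  qed (simp add: additive.diff[OF additive_dZ] additive.diff[OF additive_lie_deriv])
  then show ?thesis by blast
qed

text \<open>In the same way the square commutes with exterior multiplications and vanishes on
  \<open>A \<otimes> 1\<close>.\<close>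

lemma dZ_dZ: "dZ (dZ z) = 0"
proof (induction z rule: ext_mult_induct)
  case (generator a)
  show ?case by (simp add: dZ_generator additive.zero[OF additive_dZ])
next
  case (ext_mult y z)
  then show ?case
    by (simp add: dZ_ext_mult additive.diff[OF additive_dZ] dZ_lie_deriv rho_zero)
qed (simp add: additive.diff[OF additive_dZ])


section \<open>Matrix coefficients of the action\<close>

abbreviation Xp :: "int \<Rightarrow> 'x set" where "Xp \<equiv> tensor_component tX L_deg"
abbreviation Zp :: "int \<Rightarrow> 'z set" where "Zp \<equiv> tensor_component tZ Xp"
abbreviation Bn :: "int \<Rightarrow> 'b set" where "Bn \<equiv> tensor_component tB C_deg"

lemma Zp_eq: "Zp p = group_closure {s a l | a l. l \<in> L_deg p}"
proof (intro set_eqI iffI)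
  fix z assume "z \<in> Zp p"
  then have "z \<in> group_closure {tZ a x | a x. x \<in> Xp p}" by (simp add: tensor_component_def)
  then show "z \<in> group_closure {s a l | a l. l \<in> L_deg p}"
  proof (rule group_closure_trans[rotated])
    fix z assume "z \<in> {tZ a x | a x. x \<in> Xp p}"
    then obtain a x where z: "z = tZ a x" and "x \<in> Xp p" by blast
    from this(2) have x: "x \<in> group_closure {tX u l | u l. l \<in> L_deg p}"
      by (simp add: tensor_component_def)
    show "z \<in> group_closure {s a l | a l. l \<in> L_deg p}"
      unfolding z
    proof (rule additive_image_group_closure[OF additive_tZ(2) _ x])
      fix y assume "y \<in> {tX u l | u l. l \<in> L_deg p}"
      then obtain u l where "y = tX u l" and l: "l \<in> L_deg p" by blast
      then have "tZ a y = s (a * incl u) l" by (simp add: tZ_tX)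
      with l show "tZ a y \<in> group_closure {s a l | a l. l \<in> L_deg p}"
        by (intro group_closure_base CollectI exI conjI)
    qed
  qed
next
  fix z assume "z \<in> group_closure {s a l | a l. l \<in> L_deg p}"
  then have "z \<in> group_closure {tZ a x | a x. x \<in> Xp p}"
  proof (rule group_closure_trans[rotated])
    fix z assume "z \<in> {s a l | a l. l \<in> L_deg p}"
    then obtain a l where z: "z = s a l" and l: "l \<in> L_deg p" by blast
    from l have "tX 1 l \<in> Xp p"
      unfolding tensor_component_def by (intro group_closure_base) blast
    then show "z \<in> group_closure {tZ a x | a x. x \<in> Xp p}"
      unfolding z s_def by (intro group_closure_base) blast
  qed
  then show "z \<in> Zp p" by (simp add: tensor_component_def)
qed

lemma Zp_closed: "0 \<in> Zp p" "z \<in> Zp p \<Longrightarrow> z' \<in> Zp p \<Longrightarrow> z + z' \<in> Zp p"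
  unfolding Zp_eq by (auto intro: group_closure_add)

lemma s_in_Zp: "l \<in> L_deg p \<Longrightarrow> s a l \<in> Zp p"
  unfolding Zp_eq by (intro group_closure_base) blast

lemma additive_maps_Zp:
  assumes "additive f" "\<And>a l. l \<in> L_deg p \<Longrightarrow> f (s a l) \<in> Zp q" "z \<in> Zp p"
  shows "f z \<in> Zp q"
  unfolding Zp_eq[of q]
proof (rule additive_image_group_closure[OF assms(1) _ assms(3)[unfolded Zp_eq[of p]]])
  fix y assume "y \<in> {s a l | a l. l \<in> L_deg p}"
  then obtain a l where "y = s a l" "l \<in> L_deg p" by blast
  then show "f y \<in> group_closure {s a l | a l. l \<in> L_deg q}"
    using assms(2) by (simp flip: Zp_eq)
qed

lemma Z_act_Zp: "z \<in> Zp p \<Longrightarrow> Z_act a z \<in> Zp p"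
  by (rule additive_maps_Zp[OF additive_Z_act]) (auto simp: Z_act s_in_Zp)

lemma tB_in_Bn: "c \<in> C_deg n \<Longrightarrow> tB a c \<in> Bn n"
  unfolding tensor_component_def by (intro group_closure_base) blast

lemma Bn_closed: "0 \<in> Bn n" "b \<in> Bn n \<Longrightarrow> b' \<in> Bn n \<Longrightarrow> b + b' \<in> Bn n"
  "b \<in> Bn n \<Longrightarrow> b' \<in> Bn n \<Longrightarrow> b - b' \<in> Bn n" "(\<And>i. i \<in> I \<Longrightarrow> f i \<in> Bn n) \<Longrightarrow> sum f I \<in> Bn n"
  unfolding tensor_component_def
  by (auto intro: group_closure_add group_closure.diff group_closure_sum_mem)

lemma additive_maps_tensor_component:
  assumes "additive f" "\<And>a c. c \<in> C_deg m \<Longrightarrow> f (tB a c) \<in> tensor_component t D n" "b \<in> Bn m"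
  shows "f b \<in> tensor_component t D n"
  unfolding tensor_component_def[of t]
proof (rule additive_image_group_closure[OF assms(1) _ assms(3)[unfolded tensor_component_def]])
  fix y assume "y \<in> {tB a c | a c. c \<in> C_deg m}"
  then obtain a c where "y = tB a c" "c \<in> C_deg m" by blast
  then show "f y \<in> group_closure {t u v | u v. v \<in> D n}"
    using assms(2) by (simp flip: tensor_component_def)
qed

lemma Bn_mult:
  assumes "b \<in> Bn m" "b' \<in> Bn n"
  shows "b * b' \<in> Bn (m + n)"
proof (rule additive_maps_tensor_component[OF _ _ assms(1), where f = "\<lambda>b. b * b'"])
  show "additive (\<lambda>b. b * b')" by (simp add: additive_def distrib_right)
  fix a c assume c: "c \<in> C_deg m"
  show "tB a c * b' \<in> Bn (m + n)"
  proof (rule additive_maps_tensor_component[OF _ _ assms(2), where f = "\<lambda>b'. tB a c * b'"])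
    show "additive (\<lambda>b'. tB a c * b')" by (simp add: additive_def distrib_left)
    show "tB a c * tB a' c' \<in> Bn (m + n)" if "c' \<in> C_deg n" for a' c'
      using C_deg_mult[OF c that] by (simp add: tB_mult tB_in_Bn)
  qed
qed

lemma rho_Zp:
  assumes "b \<in> Bn n" "z \<in> Zp p"
  shows "rho b z \<in> Zp (p - n)"
proof -
  have "rho (tB a c) z \<in> Zp (p - n)" if c: "c \<in> C_deg n" for a c
    by (rule additive_maps_Zp[OF additive_rho _ assms(2)]) (simp add: rho_s C_deg_act[OF c] s_in_Zp)
  then show ?thesis
    by (rule additive_maps_tensor_component[OF additive_rho_left _ assms(1)])
qed

lemma d_in_Bn: "d \<in> Bn 1"
proof -
  have "vec x * cov (dual i) * cov (dual j) \<in> C_deg 1" for x i j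
    using C_deg_mult[OF C_deg_mult[OF C_deg_vec C_deg_cov] C_deg_cov, of "dual i" "dual j" x]
    by (simp add: dual_in_dual_space)
  then show ?thesis
    unfolding brst_element_def
    by (intro Bn_closed(2,4) tB_in_Bn C_deg_cov dual_in_dual_space)
qed

definition Z_coord :: "nat set \<Rightarrow> 'z \<Rightarrow> 'a" where
  "Z_coord I = s_lift (\<lambda>a l. sA (coord I l) a)"

lemma
  shows additive_Z_coord: "additive (Z_coord I)"
    and Z_coord_s: "Z_coord I (s a l) = sA (coord I l) a"
proof -
  have "balanced_map (\<lambda>a k. sA k a) sL (\<lambda>a l. sA (coord I l) a)"
    by (rule balanced_mapI)
      (simp_all add: A.scale_right_distrib A.scale_left_distrib coord_add coord_scale mult.commute)
  from additive_s_lift[OF this] s_lift_apply[OF this]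
  show "additive (Z_coord I)" "Z_coord I (s a l) = sA (coord I l) a"
    by (simp_all add: Z_coord_def)
qed

lemma Z_expansion: "z = (\<Sum>I\<in>Pow {..<N}. s (Z_coord I z) (monom I))"
proof (rule s_ext[where f = "\<lambda>z. z" and g = "\<lambda>z. \<Sum>I\<in>Pow {..<N}. s (Z_coord I z) (monom I)"])
  show "additive (\<lambda>z. \<Sum>I\<in>Pow {..<N}. s (Z_coord I z) (monom I))"
    by (intro additive_sum additive_compose[OF additive_s(1) additive_Z_coord])
  fix a l
  show "s a l = (\<Sum>I\<in>Pow {..<N}. s (Z_coord I (s a l)) (monom I))"
    by (simp add: Z_coord_s s_scale flip: s_sum_right monom_expansion)
qed (simp add: additive_def)

lemma Z_coord_Zp:
  assumes "z \<in> Zp p" "I \<subseteq> {..<N}" "p \<noteq> int (card I)"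
  shows "Z_coord I z = 0"
proof -
  have zero: "additive (\<lambda>z :: 'z. 0 :: 'a)" by (simp add: additive_def)
  show ?thesis
    by (rule additive_eq_on_group_closure[OF additive_Z_coord zero _ assms(1)[unfolded Zp_eq]])
      (auto simp: Z_coord_s coord_L_deg[OF _ assms(2,3)])
qed

definition from_matrix :: "(nat set \<Rightarrow> nat set \<Rightarrow> 'a) \<Rightarrow> 'b" where
  "from_matrix \<beta> = (\<Sum>I\<in>Pow {..<N}. \<Sum>J\<in>Pow {..<N}. tB (\<beta> I J) (matrix_unit I J))"

lemma from_matrix_surj: "\<exists>\<beta>. b = from_matrix \<beta>"
proof -
  have "b \<in> range from_matrix"
  proof (rule group_closure_least[OF tensor_product_generated[OF tB_tensor]])
    show "{tB a c | a c. True} \<subseteq> range from_matrix"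
    proof clarify
      fix a c
      obtain m where c: "c = (\<Sum>I\<in>Pow {..<N}. \<Sum>J\<in>Pow {..<N}. sC (m I J) (matrix_unit I J))"
        using matrix_units_span by blast
      have "tB a c = from_matrix (\<lambda>I J. sA (m I J) a)"
        by (subst c) (simp add: from_matrix_def additive.sum[OF additive_tB(2)] tB_simps(3))
      then show "tB a c \<in> range from_matrix" by blast
    qed
    show "b - b' \<in> range from_matrix"
      if range: "b \<in> range from_matrix" "b' \<in> range from_matrix" for b b'
    proof -
      obtain \<beta> \<beta>' where "b = from_matrix \<beta>" "b' = from_matrix \<beta>'" using range by blast
      then have "b - b' = from_matrix (\<lambda>I J. \<beta> I J - \<beta>' I J)"
        by (simp add: from_matrix_def additive.diff[OF additive_tB(1)] sum_subtractf)
      then show ?thesis by blast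
    qed
    have "from_matrix (\<lambda>I J. 0) = 0"
      by (simp add: from_matrix_def additive.zero[OF additive_tB(1)])
    then show "0 \<in> range from_matrix" by (metis rangeI)
  qed
  then show ?thesis by blast
qed

lemma rho_from_matrix:
  assumes "K \<subseteq> {..<N}"
  shows "rho (from_matrix \<beta>) (s a (monom K)) = (\<Sum>I\<in>Pow {..<N}. s (a * \<beta> I K) (monom I))"
proof -
  have "(\<Sum>J\<in>Pow {..<N}. s (a * \<beta> I J) (act (matrix_unit I J) (monom K))) = s (a * \<beta> I K) (monom I)" for I
  proof -
    have "(\<Sum>J\<in>Pow {..<N}. s (a * \<beta> I J) (act (matrix_unit I J) (monom K))) =
        (\<Sum>J\<in>Pow {..<N}. if J = K then s (a * \<beta> I J) (monom I) else 0)"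
      by (rule sum.cong) (use assms in \<open>auto simp: act_unit_monom\<close>)
    then show ?thesis using assms by simp
  qed
  then show ?thesis
    by (simp add: from_matrix_def rho_sum_left rho_s)
qed

lemma Z_coord_rho_from_matrix:
  assumes "I \<subseteq> {..<N}" "K \<subseteq> {..<N}"
  shows "Z_coord I (rho (from_matrix \<beta>) (s 1 (monom K))) = \<beta> I K"
proof -
  have "Z_coord I (rho (from_matrix \<beta>) (s 1 (monom K))) =
      (\<Sum>J\<in>Pow {..<N}. if J = I then \<beta> J K else 0)"
    unfolding rho_from_matrix[OF assms(2)] additive.sum[OF additive_Z_coord] Z_coord_s
    by (rule sum.cong) (use assms in \<open>auto simp: coord_monom\<close>)
  then show ?thesis using assms(1) by simp
qed

text \<open>The entries of the matrix of \<open>b\<close> are coordinates of its values on the monomials.\<close>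

lemma rho_faithful:
  assumes "\<And>z. rho b z = 0"
  shows "b = 0"
proof -
  obtain \<beta> where b: "b = from_matrix \<beta>" using from_matrix_surj by blast
  have "\<beta> I J = 0" if "I \<subseteq> {..<N}" "J \<subseteq> {..<N}" for I J
    using Z_coord_rho_from_matrix[OF that, of \<beta>] assms
    by (simp add: b additive.zero[OF additive_Z_coord])
  then show ?thesis
    by (simp add: b from_matrix_def additive.zero[OF additive_tB(1)])
qed

lemma d_d: "d * d = 0"
  by (rule rho_faithful) (simp add: rho_mult rho_d dZ_dZ)


section \<open>The isomorphism\<close>

abbreviation EndA :: "('k, int \<Rightarrow> 'z \<Rightarrow> 'z) dga" where "EndA \<equiv> End_dga Z_act Z_scale Zp dZ"
abbreviation BRST :: "('k, 'b) dga" where "BRST \<equiv> BRST_dga B_scale Bn d"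

lemma is_complex_BRST: "is_complex BRST"
  unfolding is_complex_def
proof (intro allI ballI conjI)
  fix n x assume x: "x \<in> dg_carrier BRST n"
  then show "dg_diff BRST n x \<in> dg_carrier BRST (n + 1)"
    using Bn_mult[OF d_in_Bn, of x n] Bn_mult[OF _ d_in_Bn, of x n]
    by (auto simp: BRST_dga_def sgn_pow_def add.commute intro: Bn_closed)
  have "d * (d * y) = 0" "y * d * d = 0" for y
    using d_d by (simp_all add: mult.assoc flip: mult.assoc[of d d])
  then show "dg_diff BRST (n + 1) (dg_diff BRST n x) = dg_zero BRST"
    by (simp add: BRST_dga_def sgn_pow_def algebra_simps)
qed

text \<open>In every degree the family consists of restrictions of one operator on the whole complex.\<close>

definition phi :: "int \<Rightarrow> 'b \<Rightarrow> int \<Rightarrow> 'z \<Rightarrow> 'z" where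
  "phi n b = (\<lambda>p. \<lambda>z\<in>Zp p. rho b z)"

lemma phi_mem: "b \<in> Bn n \<Longrightarrow> phi n b \<in> dg_carrier EndA n"
  by (auto simp: End_dga_def phi_def module_homs_def rho_Zp rho_add Zp_closed Z_act_Zp rho_Z_act)

lemma phi_inject:
  assumes "phi n b = phi n b'"
  shows "b = b'"
proof -
  have eq: "rho b z = rho b' z" if "z \<in> Zp p" for z p
    using fun_cong[OF fun_cong[OF assms, of p], of z] that by (simp add: phi_def)
  have on_s: "rho b (s a l) = rho b' (s a l)" for a l
  proof (induction l arbitrary: a rule: wedge_induct)
    case (wedge xs)
    show ?case by (rule eq[OF s_in_Zp[OF L_deg_wedge]])
  next
    case (add l l')
    then show ?case by (simp only: s_add_right rho_add)
  next
    case (scale k l)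
    then show ?case by (simp only: s_scale[symmetric])
  qed
  have "rho b z = rho b' z" for z
    by (rule s_ext[OF additive_rho additive_rho on_s])
  then have "b - b' = 0"
    by (intro rho_faithful) (simp add: rho_diff_left)
  then show ?thesis by simp
qed

lemma sum_on_Zp:
  assumes f: "f \<in> module_homs Z_act (Zp p) (Zp q)" and z: "\<And>i. i \<in> I \<Longrightarrow> z i \<in> Zp p"
  shows "f (\<Sum>i\<in>I. z i) = (\<Sum>i\<in>I. f (z i))"
proof -
  have f0: "f 0 = 0"
  proof -
    have "f (0 + 0) = f 0 + f 0" using f Zp_closed(1) unfolding module_homs_def by blast
    then show ?thesis by simp
  qed
  have "(\<Sum>i\<in>I. z i) \<in> Zp p \<and> f (\<Sum>i\<in>I. z i) = (\<Sum>i\<in>I. f (z i))"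
    using z
  proof (induction I rule: infinite_finite_induct)
    case (insert i I)
    then show ?case using f Zp_closed(2) by (auto simp: module_homs_def)
  qed (simp_all add: f0 Zp_closed)
  then show ?thesis by blast
qed

text \<open>A family of homomorphisms is the action of the matrix of its values on the monomials.  Entries
  of the wrong degree vanish, so this matrix lies in the right component.\<close>

lemma phi_surj:
  assumes "f \<in> dg_carrier EndA n"
  shows "\<exists>b\<in>Bn n. phi n b = f"
proof -
  have f: "f p \<in> module_homs Z_act (Zp p) (Zp (p - n))" for p
    using assms by (simp add: End_dga_def)
  have f_mem: "f p z \<in> Zp (p - n)" and f_act: "f p (Z_act a z) = Z_act a (f p z)"
    if "z \<in> Zp p" for p z a
    using f[of p] that by (auto simp: module_homs_def)
  define \<beta> where "\<beta> I J = Z_coord I (f (int (card J)) (s 1 (monom J)))" for I J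
  have monom_mem: "s a (monom J) \<in> Zp (int (card J))" if "J \<subseteq> {..<N}" for a J
    by (rule s_in_Zp[OF monom_deg[OF that]])
  have "from_matrix \<beta> \<in> Bn n"
    unfolding from_matrix_def
  proof (intro Bn_closed(4))
    fix I J assume "I \<in> Pow {..<N}" "J \<in> Pow {..<N}"
    then have IJ: "I \<subseteq> {..<N}" "J \<subseteq> {..<N}" by auto
    show "tB (\<beta> I J) (matrix_unit I J) \<in> Bn n"
    proof (cases "int (card J) - n = int (card I)")
      case True
      then have "int (card J) - int (card I) = n" by simp
      then show ?thesis using C_deg_unit[OF IJ] by (simp add: tB_in_Bn)
    next
      case False
      then have "\<beta> I J = 0"
        unfolding \<beta>_def by (intro Z_coord_Zp[OF f_mem[OF monom_mem]] IJ)
      then show ?thesis by (simp add: additive.zero[OF additive_tB(1)] Bn_closed)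
    qed
  qed
  moreover have "phi n (from_matrix \<beta>) = f"
  proof (intro ext)
    fix p z
    show "phi n (from_matrix \<beta>) p z = f p z"
    proof (cases "z \<in> Zp p")
      case False
      then show ?thesis using f[of p] by (auto simp: phi_def module_homs_def PiE_def extensional_def)
    next
      case True
      let ?t = "\<lambda>I. s (Z_coord I z) (monom I)"
      have on_monom: "rho (from_matrix \<beta>) (s a (monom K)) = f (int (card K)) (s a (monom K))"
        if K: "K \<subseteq> {..<N}" for a K
      proof -
        have "rho (from_matrix \<beta>) (s a (monom K)) = Z_act a (\<Sum>I\<in>Pow {..<N}. s (\<beta> I K) (monom I))"
          by (simp add: rho_from_matrix[OF K] additive.sum[OF additive_Z_act] Z_act)
        also have "(\<Sum>I\<in>Pow {..<N}. s (\<beta> I K) (monom I)) = f (int (card K)) (s 1 (monom K))"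
          unfolding \<beta>_def by (rule Z_expansion[symmetric])
        also have "Z_act a \<dots> = f (int (card K)) (s a (monom K))"
          by (simp add: Z_act flip: f_act[OF monom_mem[OF K]])
        finally show ?thesis .
      qed
      have summand: "?t I \<in> Zp p \<and> rho (from_matrix \<beta>) (?t I) = f p (?t I)" if "I \<in> Pow {..<N}" for I
      proof (cases "p = int (card I)")
        case True
        then show ?thesis using that on_monom monom_mem by auto
      next
        case False
        then have "?t I = 0" using Z_coord_Zp[OF \<open>z \<in> Zp p\<close>] that by simp
        then show ?thesis
          using sum_on_Zp[OF f[of p], of "{}"] by (simp add: Zp_closed rho_zero)
      qed
      have "rho (from_matrix \<beta>) z = (\<Sum>I\<in>Pow {..<N}. rho (from_matrix \<beta>) (?t I))"
        by (subst Z_expansion) (rule additive.sum[OF additive_rho])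
      also have "\<dots> = (\<Sum>I\<in>Pow {..<N}. f p (?t I))"
        using summand by (intro sum.cong) auto
      also have "\<dots> = f p (\<Sum>I\<in>Pow {..<N}. ?t I)"
        using summand by (intro sum_on_Zp[OF f, symmetric]) auto
      also have "\<dots> = f p z" by (simp flip: Z_expansion)
      finally show ?thesis using True by (simp add: phi_def)
    qed
  qed
  ultimately show ?thesis by blast
qed

lemma dga_isomorphism_phi: "dga_isomorphism BRST EndA phi"
  unfolding dga_isomorphism_def
proof (intro conjI allI ballI)
  fix n
  show "bij_betw (phi n) (dg_carrier BRST n) (dg_carrier EndA n)"
    using phi_inject[of n] phi_mem[of _ n] phi_surj[of _ n]
    by (auto simp: bij_betw_def inj_on_def BRST_dga_def image_iff) metis
next
  fix n x y assume "x \<in> dg_carrier BRST n" "y \<in> dg_carrier BRST n"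
  show "phi n (dg_add BRST x y) = dg_add EndA (phi n x) (phi n y)"
    by (intro ext) (simp add: phi_def BRST_dga_def End_dga_def rho_add_left restrict_def)
next
  fix n c x assume "x \<in> dg_carrier BRST n"
  show "phi n (dg_scale BRST c x) = dg_scale EndA c (phi n x)"
    by (intro ext) (simp add: phi_def BRST_dga_def End_dga_def rho_B_scale restrict_def)
next
  fix m n x y assume "x \<in> dg_carrier BRST m" "y \<in> dg_carrier BRST n"
  then show "phi (m + n) (dg_mult BRST m n x y) = dg_mult EndA m n (phi m x) (phi n y)"
    by (intro ext) (simp add: phi_def BRST_dga_def End_dga_def rho_mult compose_def restrict_def rho_Zp)
next
  show "phi 0 (dg_one BRST) = dg_one EndA"
    by (intro ext) (simp add: phi_def BRST_dga_def End_dga_def rho_one restrict_def)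
next
  fix n x assume "x \<in> dg_carrier BRST n"
  have "dZ z \<in> Zp (p - 1)" if "z \<in> Zp p" for z p
    using rho_Zp[OF d_in_Bn that] by (simp add: rho_d)
  then show "phi (n + 1) (dg_diff BRST n x) = dg_diff EndA n (phi n x)"
    by (intro ext) (simp add: phi_def BRST_dga_def End_dga_def restrict_def sgn_pow_def rho_mult rho_d
        rho_diff_left rho_minus_left rho_add_left)
qed

lemma is_complex_EndA: "is_complex EndA"
proof (rule is_complex_transfer[OF dga_isomorphism_phi is_complex_BRST])
  show "phi n (dg_zero BRST) = dg_zero EndA" for n
    by (intro ext) (simp add: phi_def BRST_dga_def End_dga_def rho_zero_left)
qed

end

theorem theorem8:
  fixes sg :: "'k::field \<Rightarrow> 'g::ab_group_add \<Rightarrow> 'g"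
    and br :: "'g \<Rightarrow> 'g \<Rightarrow> 'g"
    and N :: nat and e :: "nat \<Rightarrow> 'g"
    and sU :: "'k \<Rightarrow> 'u::ring_1 \<Rightarrow> 'u" and iU :: "'g \<Rightarrow> 'u"
    and sA :: "'k \<Rightarrow> 'a::ring_1 \<Rightarrow> 'a" and incl :: "'u \<Rightarrow> 'a"
    and sL :: "'k \<Rightarrow> 'l::ring_1 \<Rightarrow> 'l" and iL :: "'g \<Rightarrow> 'l"
    and tX :: "'u \<Rightarrow> 'l \<Rightarrow> 'x::ab_group_add"
    and tZ :: "'a \<Rightarrow> 'x \<Rightarrow> 'z::ab_group_add"
    and sC :: "'k \<Rightarrow> 'c::ring_1 \<Rightarrow> 'c" and iC :: "'g + ('g \<Rightarrow> 'k) \<Rightarrow> 'c"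
    and tB :: "'a \<Rightarrow> 'c \<Rightarrow> 'b::ring_1"
  assumes g: "lie_algebra sg br"
    and e: "linear_basis sg N e"
    and U: "enveloping_algebra sg br sU iU"
    and A: "assoc_algebra sA"
    and incl: "algebra_hom sU sA incl" "inj incl"
    and L: "exterior_algebra sg sL iL"
    and X: "tensor_product (\<lambda>u k. sU k u) sL tX"
    and Z: "tensor_product (\<lambda>a u. a * incl u) (left_mult_action tX) tZ"
    and C: "clifford_algebra sg sC iC"
    and B: "opp_tensor_algebra sA sC tB"
  defines "dX \<equiv> resolution_diff br iU iL tX"
    and "Xp \<equiv> tensor_component tX (exterior_power sL iL)"
  defines "dZ \<equiv> tensor_lift tZ (\<lambda>a x. tZ a (dX x))"
    and "Zp \<equiv> tensor_component tZ Xp"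
    and "Bn \<equiv> tensor_component tB (clifford_component sg sC iC)"
    and "d \<equiv> brst_element sg br N e (\<lambda>x. incl (iU x)) iC tB"
  defines "EndA \<equiv> End_dga (left_mult_action tZ) (left_scale sA tZ) Zp dZ"
    and "BRST \<equiv> BRST_dga (left_scale sA tB) Bn d"
  shows "is_complex EndA \<and> is_complex BRST \<and> (\<exists>\<phi>. dga_isomorphism BRST EndA \<phi>)"
proof -
  interpret brst sg br N e sL iL sC iC sU iU sA incl tX tZ tB
    using g e U A incl(1) L X Z C B
    by (simp add: brst_def brst_axioms_def clifford_def clifford_axioms_def exterior_def
        exterior_axioms_def based_lie_algebra_def based_lie_algebra_axioms_def)
  show ?thesis
    using is_complex_EndA is_complex_BRST dga_isomorphism_phi
    unfolding EndA_def BRST_def dZ_def Zp_def Bn_def d_def Xp_def dX_def by blast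
qed

end
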